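(* Consider the DZOFL iteration $\theta_{k+1}=\theta_k-\alpha_k g_k$, $k\ge 0$, described in the context, with $F=\sum_{i=1}^N F_i$, and assume that there is $\theta^*\in\mathbb{R}^d$ with $\min_{\theta\in\mathbb{R}^d}F(\theta)=F(\theta^* )>-\infty$ and $\nabla F(\theta^* )=0$. Assume: (1) For every $i\in\mathcal N$, $\nabla F_i(\theta)$ and $\nabla^2F_i(\theta)$ exist and are continuous, and there is a constant $\alpha_1>0$ such that $\|\nabla^2F_i(\theta)\|_2\le\alpha_1$ for all $\theta\in\mathbb{R}^d$ and $i\in\mathcal N$. (2) For every $i\in\mathcal N$, $|f_i(\theta,\xi_i)-f_i(\theta',\xi_i)|\le L_{\xi_i}\|\theta-\theta'\|$ for all $\theta,\theta'\in\mathbb{R}^d$, where $L_{\xi_i}$ is a Lipschitz constant depending on $\xi_i$ and $L_\xi:=\max_i\mathbb{E}[L_{\xi_{i,k}}^2\mid\mathcal H_k]$ is a finite constant; moreover $\mathbb{E}_{\xi_i}f_i(\theta,\xi_i)<\infty$. (3) The positive step sizes satisfy $\alpha_k\to0$ and $\gamma_k\to0$ as $k\to\infty$, $\sum_{k=0}^\infty\alpha_k\gamma_k=\infty$, $\sum_{k=0}^\infty\alpha_k\gamma_k^3<\infty$ and $\sum_{k=0}^\infty\alpha_k^2\gamma_k^2<\infty$. (4) The random quantizer $Q$ satisfies $\mathbb{E}[Q(x)\mid x]=x$ and $\mathbb{E}[\|Q(x)-x\|^2\mid x]\le\sigma\|x\|^2$ for some constant $\sigma>0$ and every argument $x$. (5)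 The vectors $\Phi_k=(\phi_k^1,\dots,\phi_k^d)^T$ are independent across iterations $k$; for each $k$ the entries of $\Phi_k$ are i.i.d. with $\mathbb{E}(\phi_k^{d_1}\phi_k^{d_2})=0$ for $d_1\ne d_2$; there is $\alpha_2>0$ with $\mathbb{E}(\phi_k^{d_j})^2=\alpha_2$ for all $d_j$ and $k$; and there is $\alpha_3>0$ with $\|\Phi_k\|\le\alpha_3$ for all $k$. Then $$\sum_{k}\alpha_k\gamma_k\,\mathbb{E}\big[\|\nabla F(\theta_k)\|^2\big]<+\infty\qquad\text{and}\qquad\lim_{k\to\infty}\mathbb{E}\big[\|\nabla F(\theta_k)\|^2\big]=0 .$$
   Context: Setting. $\mathcal N=\{1,\dots,N\}$ is a set of devices. For each $i\in\mathcal N$, $F_i(\theta)=\mathbb{E}_{\xi_i\sim D_i}f_i(\theta,\xi_i)$ for $\theta\in\mathbb{R}^d$, where $D_i$ is a distribution (local data), and $F=\sum_{i=1}^NF_i$. The functions may be nonconvex. DZOFL algorithm. The initial point $\theta_0\in\mathbb{R}^d$ is given (deterministic). At each iteration $k\ge0$: samples $\xi_{i,k}\sim D_i$ are drawn (i.i.d. in $k$), and a random perturbation vector $\Phi_k\in\mathbb{R}^d$ is drawn; device $i$ computes $$\Delta f_{i,k}=f_i(\theta_k+\gamma_k\Phi_k,\xi_{i,k})-f_i(\theta_k-\gamma_k\Phi_k,\xi_{i,k})$$ and sends $Q(\Delta f_{i,k})$, where $Q$ is a random quantizer. A random set $\mathcal S_k\subseteq\mathcal N$ of devices has its packets received correctly: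 independently over $i$ one has $\mathbb{P}(i\in\mathcal S_k)=p$, with $0<p\le1$. The server forms $$\Delta f_k=\frac{N}{|\mathcal S_k|}\sum_{i\in\mathcal S_k}Q(\Delta f_{i,k})\ \text{ if }|\mathcal S_k|\ne0,\qquad \Delta f_k=0\ \text{ if }|\mathcal S_k|=0,$$ and one sets $g_k=\Phi_k\,Q(\Delta f_k)$ (so $g_k=0$ if $\mathcal S_k$ is empty) and $\theta_{k+1}=\theta_k-\alpha_kg_k$, with step sizes $\alpha_k,\gamma_k>0$. Write $\xi_k=(\xi_{1,k},\dots,\xi_{N,k})$ and let $\mathcal H_k=\{\theta_0,\xi_0,\theta_1,\xi_1,\dots,\theta_{k-1},\xi_{k-1},\theta_k\}$ be the history. At iteration $k$ the quantities $\Phi_k$, $\xi_k$ and $\mathcal S_k$ are independent of each other and of the past, and every application of $Q$ uses fresh randomness independent of everything else (so the quantizer properties hold conditionally on all other variables). *)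

theory Defs
  imports "HOL-Probability.Probability"
begin

definition gradient :: "('a::real_inner \<Rightarrow> real) \<Rightarrow> 'a \<Rightarrow> 'a" where
  "gradient F x = (THE v. GDERIV F x :> v)"

definition has_gradient_at :: "('a::real_inner \<Rightarrow> real) \<Rightarrow> 'a \<Rightarrow> bool" where
  "has_gradient_at F x \<longleftrightarrow> (\<exists>v. GDERIV F x :> v)"

definition hessian :: "(real ^ 'd \<Rightarrow> real) \<Rightarrow> real ^ 'd \<Rightarrow> real ^ 'd ^ 'd" where
  "hessian F x = jacobian (gradient F) (at x)"

definition local_objective ::
  "(nat \<Rightarrow> 'x measure) \<Rightarrow> (nat \<Rightarrow> 'v \<Rightarrow> 'x \<Rightarrow> real) \<Rightarrow> nat \<Rightarrow> 'v \<Rightarrow> real" where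
  "local_objective D f i t = (\<integral>x. f i t x \<partial>D i)"

definition global_objective ::
  "nat \<Rightarrow> (nat \<Rightarrow> 'x measure) \<Rightarrow> (nat \<Rightarrow> 'v \<Rightarrow> 'x \<Rightarrow> real) \<Rightarrow> 'v \<Rightarrow> real" where
  "global_objective N D f t = (\<Sum>i\<in>{1..N}. local_objective D f i t)"

abbreviation sample_vector :: "nat \<Rightarrow> (nat \<Rightarrow> nat \<Rightarrow> 'w \<Rightarrow> 'x) \<Rightarrow> nat \<Rightarrow> 'w \<Rightarrow> nat \<Rightarrow> 'x" where
  "sample_vector N \<xi> k \<equiv> (\<lambda>\<omega>. \<lambda>i\<in>{1..N}. \<xi> i k \<omega>)"

text \<open>The sigma-algebra generated by
  \<open>\<theta> 0, \<xi> 0, \<dots>, \<theta> (k - 1), \<xi> (k - 1), \<theta> k\<close>; neither the perturbations nor the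
  reception sets nor the quantization noise belong to it.\<close>
definition history ::
  "'w measure \<Rightarrow> nat \<Rightarrow> (nat \<Rightarrow> 'x measure) \<Rightarrow> (nat \<Rightarrow> nat \<Rightarrow> 'w \<Rightarrow> 'x) \<Rightarrow>
   (nat \<Rightarrow> 'w \<Rightarrow> 'v::topological_space) \<Rightarrow> nat \<Rightarrow> 'w measure" where
  "history M N D \<xi> \<theta> k = sigma (space M)
     ((\<Union>j\<in>{..k}. sets (vimage_algebra (space M) (\<theta> j) borel)) \<union>
      (\<Union>j\<in>{..<k}. sets (vimage_algebra (space M) (sample_vector N \<xi> j) (\<Pi>\<^sub>M i\<in>{1..N}. D i))))"

text \<open>A random quantizer is represented by a jointly measurable map \<open>Q x u\<close> of its input \<open>x\<close>
  and of a seed \<open>u\<close> with law \<open>U\<close>; applying it with a seed independent of the input makes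
  integration over \<open>U\<close> the conditional expectation given \<open>x\<close>.  The integrability clauses
  exclude the default value \<open>0\<close> of a divergent integral.\<close>
definition random_quantizer :: "'u measure \<Rightarrow> (real \<Rightarrow> 'u \<Rightarrow> real) \<Rightarrow> bool" where
  "random_quantizer U Q \<longleftrightarrow>
     prob_space U \<and> (\<lambda>(x, u). Q x u) \<in> borel_measurable (borel \<Otimes>\<^sub>M U)"

definition quantizer_unbiased :: "'u measure \<Rightarrow> (real \<Rightarrow> 'u \<Rightarrow> real) \<Rightarrow> bool" where
  "quantizer_unbiased U Q \<longleftrightarrow> (\<forall>x. integrable U (Q x) \<and> (\<integral>u. Q x u \<partial>U) = x)"

definition quantizer_variance_bound :: "'u measure \<Rightarrow> (real \<Rightarrow> 'u \<Rightarrow> real) \<Rightarrow> real \<Rightarrow> bool" where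
  "quantizer_variance_bound U Q \<sigma> \<longleftrightarrow>
     (\<forall>x. integrable U (\<lambda>u. \<bar>Q x u - x\<bar>\<^sup>2) \<and> (\<integral>u. \<bar>Q x u - x\<bar>\<^sup>2 \<partial>U) \<le> \<sigma> * \<bar>x\<bar>\<^sup>2)"

text \<open>Labels of the independent sources of randomness: perturbation, data, packet reception,
  quantization at device \<open>i\<close> in iteration \<open>k\<close> (\<open>DevNoise i k\<close>), quantization at the server.\<close>
datatype source = Pert nat | Data nat | Recv nat | DevNoise nat nat | SrvNoise nat

text \<open>Here \<open>\<delta> i k\<close> is the difference formed by device \<open>i\<close>, \<open>\<Delta> k\<close> the average formed by the
  server, and \<open>V i k\<close>, \<open>W k\<close> are the seeds of the quantizer at device \<open>i\<close> and at the server.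
  No independence of the samples \<open>\<xi> i k\<close> over \<open>i\<close> is required.
  If \<open>S k \<omega>\<close> is empty then \<open>g k \<omega> = Q 0 (W k \<omega>) *\<^sub>R \<Phi> k \<omega>\<close>, which vanishes almost surely under
  \<^const>\<open>quantizer_variance_bound\<close>.\<close>
locale dzofl = prob_space M
  for M :: "'w measure" +
  fixes N :: nat
    and D :: "nat \<Rightarrow> 'x measure"
    and f :: "nat \<Rightarrow> real ^ 'd \<Rightarrow> 'x \<Rightarrow> real"
    and U :: "'u measure"
    and Q :: "real \<Rightarrow> 'u \<Rightarrow> real"
    and p :: real
    and \<alpha> \<gamma> :: "nat \<Rightarrow> real"
    and \<xi> :: "nat \<Rightarrow> nat \<Rightarrow> 'w \<Rightarrow> 'x"
    and \<Phi> :: "nat \<Rightarrow> 'w \<Rightarrow> real ^ 'd"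
    and S :: "nat \<Rightarrow> 'w \<Rightarrow> nat set"
    and V :: "nat \<Rightarrow> nat \<Rightarrow> 'w \<Rightarrow> 'u"
    and W :: "nat \<Rightarrow> 'w \<Rightarrow> 'u"
    and \<theta>0 :: "real ^ 'd"
    and \<delta> :: "nat \<Rightarrow> nat \<Rightarrow> 'w \<Rightarrow> real"
    and \<Delta> :: "nat \<Rightarrow> 'w \<Rightarrow> real"
    and g :: "nat \<Rightarrow> 'w \<Rightarrow> real ^ 'd"
    and \<theta> :: "nat \<Rightarrow> 'w \<Rightarrow> real ^ 'd"
  assumes N_pos: "1 \<le> N"
    and prob_space_D: "i \<in> {1..N} \<Longrightarrow> prob_space (D i)"
    and f_measurable: "i \<in> {1..N} \<Longrightarrow> f i t \<in> borel_measurable (D i)"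
    and quantizer: "random_quantizer U Q"
    and p_bounds: "0 < p" "p \<le> 1"
    and \<xi>_measurable: "i \<in> {1..N} \<Longrightarrow> \<xi> i k \<in> measurable M (D i)"
    and \<xi>_distr: "i \<in> {1..N} \<Longrightarrow> distr M (D i) (\<xi> i k) = D i"
    and \<Phi>_measurable: "\<Phi> k \<in> borel_measurable M"
    and S_measurable: "S k \<in> measurable M (count_space (Pow {1..N}))"
    and S_prob: "i \<in> {1..N} \<Longrightarrow> prob {\<omega> \<in> space M. i \<in> S k \<omega>} = p"
    and S_indep: "indep_events (\<lambda>i. {\<omega> \<in> space M. i \<in> S k \<omega>}) {1..N}"
    and V_measurable: "i \<in> {1..N} \<Longrightarrow> V i k \<in> measurable M U"
    and V_distr: "i \<in> {1..N} \<Longrightarrow> distr M U (V i k) = U"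
    and W_measurable: "W k \<in> measurable M U"
    and W_distr: "distr M U (W k) = U"
    and sources_indep:
      "indep_sets
        (\<lambda>s. case s of
            Pert k \<Rightarrow> sets (vimage_algebra (space M) (\<Phi> k) borel)
          | Data k \<Rightarrow> sets (vimage_algebra (space M) (sample_vector N \<xi> k) (\<Pi>\<^sub>M i\<in>{1..N}. D i))
          | Recv k \<Rightarrow> sets (vimage_algebra (space M) (S k) (count_space (Pow {1..N})))
          | DevNoise i k \<Rightarrow> sets (vimage_algebra (space M) (V i k) U)
          | SrvNoise k \<Rightarrow> sets (vimage_algebra (space M) (W k) U))
        (range Pert \<union> range Data \<union> range Recv \<union> {DevNoise i k | i k. i \<in> {1..N}} \<union> range SrvNoise)"
    and \<delta>_eq: "\<omega> \<in> space M \<Longrightarrow> i \<in> {1..N} \<Longrightarrow>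
      \<delta> i k \<omega> = f i (\<theta> k \<omega> + \<gamma> k *\<^sub>R \<Phi> k \<omega>) (\<xi> i k \<omega>) - f i (\<theta> k \<omega> - \<gamma> k *\<^sub>R \<Phi> k \<omega>) (\<xi> i k \<omega>)"
    and \<Delta>_eq: "\<omega> \<in> space M \<Longrightarrow>
      \<Delta> k \<omega> = (if card (S k \<omega>) \<noteq> 0
               then real N / real (card (S k \<omega>)) * (\<Sum>i\<in>S k \<omega>. Q (\<delta> i k \<omega>) (V i k \<omega>)) else 0)"
    and g_eq: "\<omega> \<in> space M \<Longrightarrow> g k \<omega> = Q (\<Delta> k \<omega>) (W k \<omega>) *\<^sub>R \<Phi> k \<omega>"
    and \<theta>_0: "\<omega> \<in> space M \<Longrightarrow> \<theta> 0 \<omega> = \<theta>0"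
    and \<theta>_Suc: "\<omega> \<in> space M \<Longrightarrow> \<theta> (Suc k) \<omega> = \<theta> k \<omega> - \<alpha> k *\<^sub>R g k \<omega>"

end

theory Submission
  imports Defs
begin

text \<open>Integrating out the randomness of iteration \<open>k\<close> one source at a time (quantizers,
  reception, data) gives
  \<open>E[\<nabla>F(\<theta>\<^sub>k) \<bullet> g\<^sub>k] = c\<^sub>k E[(\<nabla>F(\<theta>\<^sub>k) \<bullet> \<Phi>\<^sub>k) (F(\<theta>\<^sub>k + \<gamma>\<^sub>k \<Phi>\<^sub>k) - F(\<theta>\<^sub>k - \<gamma>\<^sub>k \<Phi>\<^sub>k))]\<close>,
  where exchangeability of the devices makes \<open>c\<^sub>k \<ge> p\<close> a common factor; since \<open>\<nabla>F\<close> is Lipschitz and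
  \<open>E[\<Phi>\<^sub>k \<Phi>\<^sub>k\<^sup>T] = \<alpha>2 I\<close>, this is at least
  \<open>p \<alpha>2 \<gamma>\<^sub>k E\<parallel>\<nabla>F(\<theta>\<^sub>k)\<parallel>\<^sup>2 - O(\<gamma>\<^sub>k\<^sup>3)\<close>.  As \<open>E\<parallel>g\<^sub>k\<parallel>\<^sup>2 = O(\<gamma>\<^sub>k\<^sup>2)\<close>, telescoping the descent inequality
  for \<open>E F(\<theta>\<^sub>k)\<close> yields summability.  The same second-moment bound shows that
  \<open>s\<^sub>k = (E\<parallel>\<nabla>F(\<theta>\<^sub>k)\<parallel>\<^sup>2)\<^sup>1\<^sup>/\<^sup>2\<close> moves by at most \<open>O(\<alpha>\<^sub>k \<gamma>\<^sub>k)\<close> per step, which together with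
  \<open>\<Sum> \<alpha>\<^sub>k \<gamma>\<^sub>k s\<^sub>k\<^sup>2 < \<infinity>\<close> and \<open>\<Sum> \<alpha>\<^sub>k \<gamma>\<^sub>k = \<infinity>\<close> forces \<open>s\<^sub>k \<rightarrow> 0\<close>.\<close>

section \<open>Gradients and smoothness\<close>

text \<open>The definite description in \<open>gradient\<close> denotes: derivatives are unique, and
  a vector is determined by the linear form that it represents.\<close>

lemma GDERIV_gradient:
  assumes "has_gradient_at F x"
  shows "GDERIV F x :> gradient F x"
proof -
  obtain v where v: "GDERIV F x :> v"
    using assms unfolding has_gradient_at_def by blast
  have "w = v" if "GDERIV F x :> w" for w
  proof -
    have "(\<lambda>h. h \<bullet> w) = (\<lambda>h. h \<bullet> v)"
      using that v unfolding gderiv_def by (rule has_derivative_unique)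
    then show ?thesis
      by (subst vector_eq_ldot[symmetric]) (auto dest: fun_cong)
  qed
  with v show ?thesis
    unfolding gradient_def by (rule theI[where P = "\<lambda>v. GDERIV F x :> v"])
qed

lemma gradient_eqI:
  assumes "GDERIV F x :> v"
  shows "gradient F x = v"
proof -
  have "GDERIV F x :> gradient F x"
    using assms by (intro GDERIV_gradient) (auto simp: has_gradient_at_def)
  then have "(\<lambda>h. h \<bullet> gradient F x) = (\<lambda>h. h \<bullet> v)"
    using assms unfolding gderiv_def by (rule has_derivative_unique)
  then show ?thesis
    by (subst vector_eq_ldot[symmetric]) (auto dest: fun_cong)
qed

lemma GDERIV_sum:
  assumes "\<And>i. i \<in> I \<Longrightarrow> GDERIV (F i) x :> G i"
  shows "GDERIV (\<lambda>y. \<Sum>i\<in>I. F i y) x :> (\<Sum>i\<in>I. G i)"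
  using has_derivative_sum[of I F "\<lambda>i h. h \<bullet> G i" "at x"] assms
  unfolding gderiv_def by (simp add: inner_sum_right)

text \<open>Mean value inequality on the whole space: \<open>hessian F t\<close> is the matrix of
  the derivative of \<open>gradient F\<close> at \<open>t\<close>, and its operator norm is at most
  \<open>B\<close>.\<close>

lemma gradient_lipschitz_of_hessian_bound:
  fixes F :: "real ^ 'd \<Rightarrow> real"
  assumes "\<And>t. gradient F differentiable (at t)"
    and "\<And>t. onorm ((*v) (hessian F t)) \<le> B"
  shows "norm (gradient F x - gradient F y) \<le> B * norm (x - y)"
proof (rule differentiable_bound)
  show "(gradient F has_derivative (*v) (hessian F t)) (at t within UNIV)" for t
    using assms(1)[of t] unfolding jacobian_works hessian_def by simp
qed (use assms in auto)

text \<open>The mean value inequality is applied to the linearization error, whose derivative along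
  the segment has norm at most \<open>B * norm (y - x)\<close>. Having \<open>B\<close> in place of
  the sharp \<open>B / 2\<close> only changes later constants.\<close>

lemma smooth_linearization_bound:
  fixes F :: "'a::real_inner \<Rightarrow> real"
  assumes G: "\<And>x. GDERIV F x :> G x"
    and lip: "\<And>x y. norm (G x - G y) \<le> B * norm (x - y)" and "0 \<le> B"
  shows "\<bar>F y - F x - (y - x) \<bullet> G x\<bar> \<le> B * (norm (y - x))\<^sup>2"
proof -
  have "norm (F y - F x - (y - x) \<bullet> G x) \<le> norm (y - x) * (B * norm (y - x))"
  proof (rule differentiable_bound_linearization[where S = "closed_segment x y"
        and f' = "\<lambda>z h. h \<bullet> G z" and ?x0.0 = x])
    show "x + t *\<^sub>R (y - x) \<in> closed_segment x y" if "t \<in> {0..1}" for t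
      unfolding in_segment using that by (intro exI[of _ t]) (simp add: algebra_simps)
    show "(F has_derivative (\<lambda>h. h \<bullet> G z)) (at z within closed_segment x y)" for z
      using G[of z] unfolding gderiv_def by (rule has_derivative_at_withinI)
    show "onorm ((\<lambda>h. h \<bullet> G z) - (\<lambda>h. h \<bullet> G x)) \<le> B * norm (y - x)"
      if z: "z \<in> closed_segment x y" for z
    proof (rule onorm_bound)
      fix h
      have "norm (((\<lambda>h. h \<bullet> G z) - (\<lambda>h. h \<bullet> G x)) h) = \<bar>h \<bullet> (G z - G x)\<bar>"
        by (simp add: inner_diff_right)
      also have "\<dots> \<le> norm h * norm (G z - G x)"
        by (rule Cauchy_Schwarz_ineq2)
      also have "\<dots> \<le> norm h * (B * norm (y - x))"
        using lip[of z x] segment_bound1[OF z] \<open>0 \<le> B\<close>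
        by (intro mult_left_mono order_trans[OF lip]) auto
      finally show "norm (((\<lambda>h. h \<bullet> G z) - (\<lambda>h. h \<bullet> G x)) h) \<le> B * norm (y - x) * norm h"
        by (simp add: mult_ac)
    qed (use \<open>0 \<le> B\<close> in simp)
  qed auto
  then show ?thesis
    by (simp add: power2_eq_square mult_ac)
qed

section \<open>A deterministic convergence criterion\<close>

text \<open>The cubes \<open>s k ^ 3\<close> have summable increments, of order
  \<open>w k * ((s k)\<^sup>2 + (w k)\<^sup>2)\<close>, so \<open>s\<close> converges; a nonzero limit would make
  \<open>\<Sum>k. w k * (s k)\<^sup>2\<close> diverge along with \<open>\<Sum>k. w k\<close>.\<close>
lemma tendsto_zero_of_slow_variation:
  fixes s w :: "nat \<Rightarrow> real"
  assumes s: "\<And>k. 0 \<le> s k" and w: "\<And>k. 0 \<le> w k"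
    and slow: "\<And>k. \<bar>s (Suc k) - s k\<bar> \<le> C * w k"
    and sum_ws: "summable (\<lambda>k. w k * (s k)\<^sup>2)"
    and sum_w2: "summable (\<lambda>k. (w k)\<^sup>2)"
    and div: "\<not> summable w"
  shows "s \<longlonglongrightarrow> 0"
proof -
  \<comment> \<open>The sign of \<open>C\<close> is unknown; a nonnegative constant makes the
    products below monotone.\<close>
  define K where "K = \<bar>C\<bar>"
  have "0 \<le> K" by (simp add: K_def)
  have slow': "\<bar>s (Suc k) - s k\<bar> \<le> K * w k" for k
    using slow[of k] mult_right_mono[OF abs_ge_self w, of C k] by (simp add: K_def)
  have "(\<lambda>k. (w k)\<^sup>2) \<longlonglongrightarrow> 0"
    using sum_w2 by (rule summable_LIMSEQ_zero)
  then have "eventually (\<lambda>k. (w k)\<^sup>2 < 1) sequentially"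
    by (rule order_tendstoD) simp
  then have w_le_1: "eventually (\<lambda>k. w k \<le> 1) sequentially"
    by eventually_elim (use w in \<open>simp add: power2_less_1_iff less_imp_le\<close>)
  have "summable (\<lambda>k. s (Suc k) ^ 3 - s k ^ 3)"
  proof (rule summable_comparison_test_ev)
    show "summable (\<lambda>k. 5 * K * (w k * (s k)\<^sup>2) + 3 * K ^ 3 * (w k)\<^sup>2)"
      using sum_ws sum_w2 by (intro summable_add summable_mult)
    show "eventually (\<lambda>k. norm (s (Suc k) ^ 3 - s k ^ 3)
        \<le> 5 * K * (w k * (s k)\<^sup>2) + 3 * K ^ 3 * (w k)\<^sup>2) sequentially"
      using w_le_1
    proof eventually_elim
      case (elim k)
      define a b where "a = s k" and "b = s (Suc k)"
      have ab: "0 \<le> a" "0 \<le> b" "\<bar>b - a\<bar> \<le> K * w k"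
        using s slow'[of k] by (auto simp: a_def b_def)
      have "b ^ 3 - a ^ 3 = (b - a) * (b\<^sup>2 + a * b + a\<^sup>2)"
        by (simp add: algebra_simps power2_eq_square power3_eq_cube)
      then have "\<bar>b ^ 3 - a ^ 3\<bar> = \<bar>b - a\<bar> * (b\<^sup>2 + a * b + a\<^sup>2)"
        using ab by (simp add: abs_mult abs_of_nonneg)
      \<comment> \<open>From \<open>b \<le> a + K * w k\<close> one gets
        \<open>b\<^sup>2 \<le> 2 * a\<^sup>2 + 2 * (K * w k)\<^sup>2\<close>, and
        \<open>a * b\<close> is at most half of \<open>a\<^sup>2 + b\<^sup>2\<close>. The total
        coefficient of \<open>a\<^sup>2\<close> is 9/2, rounded up to 5.\<close>
      also have "\<dots> \<le> (K * w k) * (5 * a\<^sup>2 + 3 * (K * w k)\<^sup>2)"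
      proof (rule mult_mono)
        have "b\<^sup>2 \<le> (a + K * w k)\<^sup>2"
          using ab by (intro power_mono) auto
        then have "b\<^sup>2 \<le> a\<^sup>2 + (K * w k)\<^sup>2 + 2 * (a * (K * w k))"
          by (simp add: power2_sum mult_ac)
        moreover have "2 * (a * (K * w k)) \<le> a\<^sup>2 + (K * w k)\<^sup>2" "2 * (a * b) \<le> a\<^sup>2 + b\<^sup>2"
          using sum_squares_bound[of a "K * w k"] sum_squares_bound[of a b] by simp_all
        ultimately show "b\<^sup>2 + a * b + a\<^sup>2 \<le> 5 * a\<^sup>2 + 3 * (K * w k)\<^sup>2"
          using zero_le_power2[of a] by linarith
      qed (use ab in auto)
      also have "\<dots> = 5 * K * (w k * a\<^sup>2) + 3 * K ^ 3 * (w k)\<^sup>2 * w k"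
        by (simp add: algebra_simps power2_eq_square power3_eq_cube)
      \<comment> \<open>Here \<open>w k \<le> 1\<close> absorbs the extra factor and turns the cubic
        term into the summable quadratic one.\<close>
      also have "\<dots> \<le> 5 * K * (w k * a\<^sup>2) + 3 * K ^ 3 * (w k)\<^sup>2"
        using elim \<open>0 \<le> K\<close> by (intro add_left_mono mult_left_le) auto
      finally show ?case by (simp add: a_def b_def)
    qed
  qed
  then have "convergent (\<lambda>n. \<Sum>k<n. s (Suc k) ^ 3 - s k ^ 3)"
    by (simp add: summable_iff_convergent)
  then obtain l where "(\<lambda>n. s n ^ 3 - s 0 ^ 3) \<longlonglongrightarrow> l"
    unfolding convergent_def sum_lessThan_telescope[of "\<lambda>k. s k ^ 3"] by blast
  then have "(\<lambda>n. s n ^ 3 - s 0 ^ 3 + s 0 ^ 3) \<longlonglongrightarrow> l + s 0 ^ 3"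
    by (intro tendsto_intros)
  \<comment> \<open>The cube root is continuous and inverts the cube on the nonnegative
    \<open>s\<close>, so convergence of the cubes gives convergence of \<open>s\<close>
    itself.\<close>
  then have "(\<lambda>n. root 3 (s n ^ 3)) \<longlonglongrightarrow> root 3 (l + s 0 ^ 3)"
    by (intro tendsto_real_root) simp
  moreover have "(\<lambda>n. root 3 (s n ^ 3)) = s"
    using s by (simp add: real_root_power_cancel)
  ultimately obtain m where lim: "s \<longlonglongrightarrow> m"
    by metis
  have "0 \<le> m"
    using lim by (rule LIMSEQ_le_const) (use s in blast)
  have "m = 0"
  proof (rule ccontr)
    assume "m \<noteq> 0"
    with \<open>0 \<le> m\<close> have "0 < m" by simp
    with lim have "eventually (\<lambda>k. m / 2 < s k) sequentially"
      by (intro order_tendstoD) auto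
    \<comment> \<open>A positive limit keeps \<open>s k\<close> above \<open>m / 2\<close>, so
      \<open>w k\<close> is dominated by a constant multiple of the summable
      \<open>w k * (s k)\<^sup>2\<close>.\<close>
    then have "eventually (\<lambda>k. norm (w k) \<le> 4 / m\<^sup>2 * (w k * (s k)\<^sup>2)) sequentially"
    proof eventually_elim
      case (elim k)
      have "(m / 2)\<^sup>2 \<le> (s k)\<^sup>2"
        using elim \<open>0 < m\<close> by (intro power_mono) auto
      then have "w k * (m / 2)\<^sup>2 \<le> w k * (s k)\<^sup>2"
        using w by (intro mult_left_mono)
      with \<open>0 < m\<close> w show ?case
        by (simp add: field_simps power2_eq_square)
    qed
    then have "summable w"
      by (rule summable_comparison_test_ev) (intro summable_mult sum_ws)
    with div show False by contradiction
  qed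
  with lim show ?thesis by simp
qed

section \<open>Independence, second moments and measurability\<close>

text \<open>The first argument is approximated pointwise by simple functions \<open>s n\<close>. For
  each \<open>n\<close> the composite is glued from finitely many measurable functions
  \<open>h t\<close>, and continuity in \<open>t\<close> carries measurability to the limit.\<close>

lemma borel_measurable_Caratheodory:
  fixes h :: "'a::{metric_space, second_countable_topology} \<Rightarrow> 'b \<Rightarrow> 'c::metric_space"
  assumes meas: "\<And>t. h t \<in> borel_measurable K"
    and cont: "\<And>x. x \<in> space K \<Longrightarrow> continuous_on UNIV (\<lambda>t. h t x)"
  shows "(\<lambda>(t, x). h t x) \<in> borel_measurable (borel \<Otimes>\<^sub>M K)"
proof -
  obtain s :: "nat \<Rightarrow> 'a \<Rightarrow> 'a" where simple: "\<And>n. simple_function borel (s n)"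
    and lim: "\<And>t. (\<lambda>n. s n t) \<longlonglongrightarrow> t"
    using borel_measurable_implies_sequence_metric[of "\<lambda>t. t" borel undefined] by auto
  show ?thesis
  proof (rule borel_measurable_LIMSEQ_metric)
    fix n
    have fin: "finite (range (s n))"
      using simple_functionD(1)[OF simple[of n]] by simp
    have "s n \<in> measurable borel (count_space (range (s n)))"
      using measurable_simple_function[OF simple[of n]] fin
      by (auto simp: measurable_count_space_eq2 measurable_def)
    then have "(\<lambda>z. s n (fst z)) \<in> measurable (borel \<Otimes>\<^sub>M K) (count_space (range (s n)))"
      by (rule measurable_compose[OF measurable_fst])
    then show "(\<lambda>z. h (s n (fst z)) (snd z)) \<in> borel_measurable (borel \<Otimes>\<^sub>M K)"
      by (rule measurable_compose_countable'[rotated])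
        (use fin in \<open>auto intro: countable_finite measurable_compose[OF measurable_snd meas]\<close>)
  next
    fix z :: "'a \<times> 'b" assume "z \<in> space (borel \<Otimes>\<^sub>M K)"
    then have "snd z \<in> space K"
      by (auto simp: space_pair_measure)
    from cont[OF this] have "isCont (\<lambda>t. h t (snd z)) (fst z)"
      by (simp add: continuous_on_eq_continuous_at)
    from isCont_tendsto_compose[OF this lim]
    show "(\<lambda>n. h (s n (fst z)) (snd z)) \<longlonglongrightarrow> (case z of (t, x) \<Rightarrow> h t x)"
      by (simp add: case_prod_beta)
  qed
qed

lemma borel_measurable_component:
  fixes X :: "'a \<Rightarrow> real ^ 'n"
  assumes "X \<in> borel_measurable K"
  shows "(\<lambda>\<omega>. X \<omega> $ j) \<in> borel_measurable K"
  using assms by (rule measurable_compose[OF _ borel_measurable_continuous_onI])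
    (auto intro: continuous_on_component continuous_on_id)

section \<open>Square-integrable functions\<close>

lemma norm_add_square_le:
  fixes a b :: "'a::real_normed_vector"
  shows "(norm (a + b))\<^sup>2 \<le> 2 * (norm a)\<^sup>2 + 2 * (norm b)\<^sup>2"
proof -
  have "(norm (a + b))\<^sup>2 \<le> (norm a + norm b)\<^sup>2"
    by (intro power_mono norm_triangle_ineq) simp
  also have "\<dots> \<le> 2 * (norm a)\<^sup>2 + 2 * (norm b)\<^sup>2"
    using sum_squares_bound[of "norm a" "norm b"] by (simp add: power2_sum)
  finally show ?thesis .
qed

lemma integrable_mult_of_squares:
  fixes X Y :: "'a \<Rightarrow> real"
  assumes [measurable]: "X \<in> borel_measurable M" "Y \<in> borel_measurable M"
    and "integrable M (\<lambda>\<omega>. (X \<omega>)\<^sup>2)" "integrable M (\<lambda>\<omega>. (Y \<omega>)\<^sup>2)"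
  shows "integrable M (\<lambda>\<omega>. X \<omega> * Y \<omega>)"
proof (rule Bochner_Integration.integrable_bound)
  show "integrable M (\<lambda>\<omega>. (X \<omega>)\<^sup>2 + (Y \<omega>)\<^sup>2)"
    using assms by simp
  have "\<bar>x * y\<bar> \<le> x\<^sup>2 + y\<^sup>2" for x y :: real
    using sum_squares_bound[of "\<bar>x\<bar>" "\<bar>y\<bar>"] abs_ge_zero[of "x * y"]
    unfolding abs_mult power2_abs by linarith
  then show "AE \<omega> in M. norm (X \<omega> * Y \<omega>) \<le> norm ((X \<omega>)\<^sup>2 + (Y \<omega>)\<^sup>2)"
    by simp
qed measurable

text \<open>Second moments are first bounded as extended nonnegative integrals, where no prior
  integrability is required; this turns such a bound into integrability and a real
  inequality.\<close>

lemma integrable_le_of_nn_integral_le: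
  fixes X :: "'a \<Rightarrow> real"
  assumes [measurable]: "X \<in> borel_measurable M" and pos: "\<And>\<omega>. 0 \<le> X \<omega>"
    and le: "(\<integral>\<^sup>+\<omega>. ennreal (X \<omega>) \<partial>M) \<le> ennreal K" and "0 \<le> K"
  shows "integrable M X" "(\<integral>\<omega>. X \<omega> \<partial>M) \<le> K"
proof -
  show int: "integrable M X"
    using pos le by (intro integrableI_nonneg) (auto simp: top_unique less_top[symmetric])
  have "ennreal (\<integral>\<omega>. X \<omega> \<partial>M) \<le> ennreal K"
    using le nn_integral_eq_integral[OF int] pos by simp
  then show "(\<integral>\<omega>. X \<omega> \<partial>M) \<le> K"
    using \<open>0 \<le> K\<close> by simp
qed

text \<open>Minkowski's inequality in L2, by expanding the square with weights: the ratio
  \<open>c / a\<close> is chosen so that the bound collapses to \<open>(a + c)\<^sup>2\<close>. A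
  positive \<open>c\<close> stands in for the norm of \<open>Z\<close>, so that both weights are
  well defined.\<close>

lemma minkowski_L2:
  fixes X Y Z :: "'a \<Rightarrow> real"
  assumes X: "integrable M (\<lambda>\<omega>. (X \<omega>)\<^sup>2)" and Y: "integrable M (\<lambda>\<omega>. (Y \<omega>)\<^sup>2)"
    and Z: "integrable M (\<lambda>\<omega>. (Z \<omega>)\<^sup>2)"
    and le: "AE \<omega> in M. \<bar>X \<omega>\<bar> \<le> \<bar>Y \<omega>\<bar> + \<bar>Z \<omega>\<bar>"
    and c: "(\<integral>\<omega>. (Z \<omega>)\<^sup>2 \<partial>M) \<le> c\<^sup>2" "0 < c"
  shows "sqrt (\<integral>\<omega>. (X \<omega>)\<^sup>2 \<partial>M) \<le> sqrt (\<integral>\<omega>. (Y \<omega>)\<^sup>2 \<partial>M) + c"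
proof (rule field_le_epsilon)
  fix e :: real assume "0 < e"
  \<comment> \<open>The slack \<open>e\<close> makes \<open>a\<close> positive even when
    \<open>Y\<close> vanishes almost everywhere, so that \<open>c / a\<close> is a genuine
    quotient.\<close>
  define a where "a = sqrt (\<integral>\<omega>. (Y \<omega>)\<^sup>2 \<partial>M) + e"
  have "0 \<le> (\<integral>\<omega>. (Y \<omega>)\<^sup>2 \<partial>M)" by simp
  then have "0 < a"
    using \<open>0 < e\<close> by (auto simp: a_def intro: add_nonneg_pos)
  have a: "(\<integral>\<omega>. (Y \<omega>)\<^sup>2 \<partial>M) \<le> a\<^sup>2"
    using \<open>0 < e\<close> by (intro sqrt_le_D) (simp add: a_def)
  text \<open>Young's inequality \<open>2 y z \<le> (c / a) y\<^sup>2 + (a / c) z\<^sup>2\<close>.\<close>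
  have young: "(y + z)\<^sup>2 \<le> (1 + c / a) * y\<^sup>2 + (1 + a / c) * z\<^sup>2" for y z :: real
  proof -
    have "0 \<le> (c * y - a * z)\<^sup>2 / (a * c)"
      using \<open>0 < a\<close> \<open>0 < c\<close> by simp
    also have "\<dots> = (c / a) * y\<^sup>2 + (a / c) * z\<^sup>2 - 2 * y * z"
      using \<open>0 < a\<close> \<open>0 < c\<close> by (simp add: field_simps power2_eq_square)
    finally show ?thesis by (simp add: algebra_simps power2_eq_square)
  qed
  have "(\<integral>\<omega>. (X \<omega>)\<^sup>2 \<partial>M) \<le> (\<integral>\<omega>. (1 + c / a) * (Y \<omega>)\<^sup>2 + (1 + a / c) * (Z \<omega>)\<^sup>2 \<partial>M)"
  proof (rule integral_mono_AE)
    show "AE \<omega> in M. (X \<omega>)\<^sup>2 \<le> (1 + c / a) * (Y \<omega>)\<^sup>2 + (1 + a / c) * (Z \<omega>)\<^sup>2"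
      using le
    proof eventually_elim
      case (elim \<omega>)
      then have "\<bar>X \<omega>\<bar>\<^sup>2 \<le> (\<bar>Y \<omega>\<bar> + \<bar>Z \<omega>\<bar>)\<^sup>2"
        by (intro power_mono) auto
      also note young
      finally show ?case by simp
    qed
  qed (use X Y Z in auto)
  also have "\<dots> = (1 + c / a) * (\<integral>\<omega>. (Y \<omega>)\<^sup>2 \<partial>M) + (1 + a / c) * (\<integral>\<omega>. (Z \<omega>)\<^sup>2 \<partial>M)"
    using Y Z by simp
  also have "\<dots> \<le> (1 + c / a) * a\<^sup>2 + (1 + a / c) * c\<^sup>2"
    using a c \<open>0 < a\<close> by (intro add_mono mult_left_mono) auto
  also have "\<dots> = (a + c)\<^sup>2"
    using \<open>0 < a\<close> \<open>0 < c\<close> by (simp add: field_simps power2_eq_square)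
  finally show "sqrt (\<integral>\<omega>. (X \<omega>)\<^sup>2 \<partial>M) \<le> sqrt (\<integral>\<omega>. (Y \<omega>)\<^sup>2 \<partial>M) + c + e"
    using \<open>0 < a\<close> \<open>0 < c\<close> real_le_lsqrt[of "a + c"] by (simp add: a_def algebra_simps)
qed

section \<open>Product laws, Fubini and random subsets\<close>

context prob_space
begin

text \<open>A product of probability measures is determined by its values on rectangles, where
  independence is exactly the product rule. Independence is asked of families containing the
  preimages, since the variables will be functions of whole groups of sources.\<close>

lemma distr_pair_of_indep_set:
  assumes ind: "indep_set \<A> \<B>"
    and [measurable]: "X \<in> measurable M A" "Y \<in> measurable M B"
    and X: "\<And>a. a \<in> sets A \<Longrightarrow> X -` a \<inter> space M \<in> \<A>"
    and Y: "\<And>b. b \<in> sets B \<Longrightarrow> Y -` b \<inter> space M \<in> \<B>"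
  shows "distr M (A \<Otimes>\<^sub>M B) (\<lambda>\<omega>. (X \<omega>, Y \<omega>)) = distr M A X \<Otimes>\<^sub>M distr M B Y"
proof -
  interpret X: prob_space "distr M A X" by (rule prob_space_distr) simp
  interpret Y: prob_space "distr M B Y" by (rule prob_space_distr) simp
  show ?thesis
  proof (rule pair_measure_eqI[symmetric])
    show "sigma_finite_measure (distr M A X)" "sigma_finite_measure (distr M B Y)" ..
    show "sets (distr M A X \<Otimes>\<^sub>M distr M B Y) = sets (distr M (A \<Otimes>\<^sub>M B) (\<lambda>\<omega>. (X \<omega>, Y \<omega>)))"
      unfolding sets_distr by (rule sets_pair_measure_cong) simp_all
  next
    fix a b assume ab: "a \<in> sets (distr M A X)" "b \<in> sets (distr M B Y)"
    then have sets: "a \<in> sets A" "b \<in> sets B" by simp_all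
    have "prob ((X -` a \<inter> space M) \<inter> (Y -` b \<inter> space M))
        = prob (X -` a \<inter> space M) * prob (Y -` b \<inter> space M)"
      using indep_setD[OF ind X[OF sets(1)] Y[OF sets(2)]] .
    moreover have "(\<lambda>\<omega>. (X \<omega>, Y \<omega>)) -` (a \<times> b) \<inter> space M
        = (X -` a \<inter> space M) \<inter> (Y -` b \<inter> space M)" by auto
    ultimately show "emeasure (distr M A X) a * emeasure (distr M B Y) b
        = emeasure (distr M (A \<Otimes>\<^sub>M B) (\<lambda>\<omega>. (X \<omega>, Y \<omega>))) (a \<times> b)"
      using sets by (simp add: emeasure_distr emeasure_eq_measure ennreal_mult)
  qed
qed

text \<open>Tonelli's theorem for independent variables: integrating over the law of
  \<open>Y\<close> with \<open>X\<close> frozen plays the part of conditional expectation given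
  \<open>X\<close>.\<close>

lemma nn_integral_joint:
  assumes [measurable]: "X \<in> measurable M A" "Y \<in> measurable M B"
    and joint: "distr M (A \<Otimes>\<^sub>M B) (\<lambda>\<omega>. (X \<omega>, Y \<omega>)) = distr M A X \<Otimes>\<^sub>M distr M B Y"
    and [measurable]: "h \<in> borel_measurable (A \<Otimes>\<^sub>M B)"
  shows "(\<integral>\<^sup>+\<omega>. h (X \<omega>, Y \<omega>) \<partial>M) = (\<integral>\<^sup>+\<omega>. (\<integral>\<^sup>+y. h (X \<omega>, y) \<partial>distr M B Y) \<partial>M)"
proof -
  interpret Y: prob_space "distr M B Y"
    by (rule prob_space_distr) simp
  have "(\<integral>\<^sup>+\<omega>. h (X \<omega>, Y \<omega>) \<partial>M) = (\<integral>\<^sup>+z. h z \<partial>distr M (A \<Otimes>\<^sub>M B) (\<lambda>\<omega>. (X \<omega>, Y \<omega>)))"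
    by (simp add: nn_integral_distr)
  also have "\<dots> = (\<integral>\<^sup>+x. (\<integral>\<^sup>+y. h (x, y) \<partial>distr M B Y) \<partial>distr M A X)"
    unfolding joint by (rule Y.nn_integral_fst[symmetric]) simp
  also have "\<dots> = (\<integral>\<^sup>+\<omega>. (\<integral>\<^sup>+y. h (X \<omega>, y) \<partial>distr M B Y) \<partial>M)"
    by (rule nn_integral_distr) (auto intro!: Y.borel_measurable_nn_integral)
  finally show ?thesis .
qed

text \<open>The Fubini counterpart for signed integrands. Integrability of the inner mean is part of
  the conclusion, so that several sources can be integrated out in succession.\<close>

lemma integral_joint:
  fixes h :: "'b \<times> 'c \<Rightarrow> real"
  assumes [measurable]: "X \<in> measurable M A" "Y \<in> measurable M B"
    and joint: "distr M (A \<Otimes>\<^sub>M B) (\<lambda>\<omega>. (X \<omega>, Y \<omega>)) = distr M A X \<Otimes>\<^sub>M distr M B Y"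
    and [measurable]: "h \<in> borel_measurable (A \<Otimes>\<^sub>M B)"
    and int: "integrable M (\<lambda>\<omega>. h (X \<omega>, Y \<omega>))"
  shows "integrable M (\<lambda>\<omega>. \<integral>y. h (X \<omega>, y) \<partial>distr M B Y)"
    and "(\<integral>\<omega>. h (X \<omega>, Y \<omega>) \<partial>M) = (\<integral>\<omega>. (\<integral>y. h (X \<omega>, y) \<partial>distr M B Y) \<partial>M)"
proof -
  interpret X: prob_space "distr M A X"
    by (rule prob_space_distr) simp
  interpret Y: prob_space "distr M B Y"
    by (rule prob_space_distr) simp
  interpret XY: pair_sigma_finite "distr M A X" "distr M B Y" ..
  have int': "integrable (distr M A X \<Otimes>\<^sub>M distr M B Y) h"
    using int by (simp add: joint[symmetric] integrable_distr_eq)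
  have [measurable]: "(\<lambda>x. \<integral>y. h (x, y) \<partial>distr M B Y) \<in> borel_measurable A"
    by (rule Y.borel_measurable_lebesgue_integral) simp
  show "integrable M (\<lambda>\<omega>. \<integral>y. h (X \<omega>, y) \<partial>distr M B Y)"
    using XY.integrable_fst'[OF int'] by (simp add: integrable_distr_eq)
  have "(\<integral>\<omega>. h (X \<omega>, Y \<omega>) \<partial>M) = (\<integral>z. h z \<partial>distr M (A \<Otimes>\<^sub>M B) (\<lambda>\<omega>. (X \<omega>, Y \<omega>)))"
    by (simp add: integral_distr)
  also have "\<dots> = (\<integral>x. (\<integral>y. h (x, y) \<partial>distr M B Y) \<partial>distr M A X)"
    unfolding joint using int' by (rule XY.integral_fst'[symmetric])
  also have "\<dots> = (\<integral>\<omega>. (\<integral>y. h (X \<omega>, y) \<partial>distr M B Y) \<partial>M)"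
    by (rule integral_distr) simp_all
  finally show "(\<integral>\<omega>. h (X \<omega>, Y \<omega>) \<partial>M) = (\<integral>\<omega>. (\<integral>y. h (X \<omega>, y) \<partial>distr M B Y) \<partial>M)" .
qed

lemma expectation_mult_joint:
  fixes X Y :: "'a \<Rightarrow> real"
  assumes [measurable]: "X \<in> borel_measurable M" "Y \<in> borel_measurable M"
    and joint: "distr M (borel \<Otimes>\<^sub>M borel) (\<lambda>\<omega>. (X \<omega>, Y \<omega>))
      = distr M borel X \<Otimes>\<^sub>M distr M borel Y"
    and int: "integrable M (\<lambda>\<omega>. X \<omega> * Y \<omega>)"
  shows "expectation (\<lambda>\<omega>. X \<omega> * Y \<omega>) = expectation X * expectation Y"
  using integral_joint(2)[OF _ _ joint, where h = "\<lambda>(x, y). x * y"] int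
  by (simp add: integral_distr)

text \<open>The event that \<open>S\<close> equals \<open>T\<close> is an intersection over
  \<open>I\<close> of membership events for indices in \<open>T\<close> and of their complements for
  the others, and independence passes to complements.\<close>

lemma prob_random_set_eq:
  assumes "finite I" and "I \<noteq> {}"
    and S: "S \<in> measurable M (count_space (Pow I))"
    and p: "\<And>i. i \<in> I \<Longrightarrow> prob {\<omega> \<in> space M. i \<in> S \<omega>} = p"
    and ind: "indep_events (\<lambda>i. {\<omega> \<in> space M. i \<in> S \<omega>}) I"
    and T: "T \<subseteq> I"
  shows "prob {\<omega> \<in> space M. S \<omega> = T} = p ^ card T * (1 - p) ^ (card I - card T)"
proof -
  define A where "A i = {\<omega> \<in> space M. i \<in> S \<omega>}" for i
  define B where "B i = (if i \<in> T then A i else space M - A i)" for i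
  have sets: "A i \<in> events" if "i \<in> I" for i
    using ind that unfolding indep_events_def A_def by blast
  \<comment> \<open>A single event forms an intersection-stable family, so independence extends to
    the sigma-algebras it generates, and these contain the complements.\<close>
  have "indep_sets (\<lambda>i. sigma_sets (space M) {A i}) I"
    using ind unfolding indep_events_def_alt A_def by (rule indep_sets_sigma) (simp add: Int_stable_def)
  moreover have "B i \<in> sigma_sets (space M) {A i}" for i
    by (cases "i \<in> T") (simp_all add: B_def sigma_sets.Basic sigma_sets.Compl)
  ultimately have "prob (\<Inter>i\<in>I. B i) = (\<Prod>i\<in>I. prob (B i))"
    using \<open>finite I\<close> \<open>I \<noteq> {}\<close> by (intro indep_setsD) auto
  \<comment> \<open>Nonemptiness of \<open>I\<close> matters: an intersection over no indices would
    be the whole type and not \<open>space M\<close>.\<close>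
  also have "(\<Inter>i\<in>I. B i) = {\<omega> \<in> space M. S \<omega> = T}"
  proof (intro equalityI subsetI)
    fix \<omega> assume "\<omega> \<in> (\<Inter>i\<in>I. B i)"
    then have B: "\<omega> \<in> B i" if "i \<in> I" for i
      using that by blast
    have iff: "\<omega> \<in> space M \<and> (i \<in> S \<omega> \<longleftrightarrow> i \<in> T)" if "i \<in> I" for i
      using B[OF that] by (cases "i \<in> T") (simp_all add: B_def A_def)
    with \<open>I \<noteq> {}\<close> have "\<omega> \<in> space M" by blast
    with iff T measurable_space[OF S this] show "\<omega> \<in> {\<omega> \<in> space M. S \<omega> = T}"
      by auto
  qed (auto simp: B_def A_def)
  also have "(\<Prod>i\<in>I. prob (B i)) = (\<Prod>i\<in>I. if i \<in> T then p else 1 - p)"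
    using sets p by (intro prod.cong) (auto simp: B_def prob_compl A_def[symmetric])
  also have "\<dots> = p ^ card T * (1 - p) ^ card (I - T)"
    using \<open>finite I\<close> T by (simp add: prod.If_cases Int_absorb1 Diff_eq)
  also have "card (I - T) = card I - card T"
    using \<open>finite I\<close> T by (simp add: card_Diff_subset finite_subset)
  finally show ?thesis .
qed

lemma expectation_finite_range:
  fixes h :: "'b \<Rightarrow> real"
  assumes "finite I" and [measurable]: "X \<in> measurable M (count_space I)"
  shows "expectation (\<lambda>\<omega>. h (X \<omega>)) = (\<Sum>x\<in>I. h x * prob {\<omega> \<in> space M. X \<omega> = x})"
proof -
  have sets: "{\<omega> \<in> space M. X \<omega> = x} \<in> events" if "x \<in> I" for x
    using that measurable_sets[OF assms(2), of "{x}"]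
    by (simp add: vimage_def Int_def conj_commute)
  have "expectation (\<lambda>\<omega>. h (X \<omega>))
      = expectation (\<lambda>\<omega>. \<Sum>x\<in>I. h x * indicator {\<omega> \<in> space M. X \<omega> = x} \<omega>)"
  proof (rule Bochner_Integration.integral_cong)
    fix \<omega> assume "\<omega> \<in> space M"
    then have "X \<omega> \<in> I" using measurable_space[OF assms(2)] by simp
    then have "h (X \<omega>) = (\<Sum>x\<in>I. if x = X \<omega> then h x else 0)"
      using \<open>finite I\<close> by simp
    also have "\<dots> = (\<Sum>x\<in>I. h x * indicator {\<omega> \<in> space M. X \<omega> = x} \<omega>)"
      using \<open>\<omega> \<in> space M\<close> by (intro sum.cong) (auto simp: indicator_def)
    finally show "h (X \<omega>) = (\<Sum>x\<in>I. h x * indicator {\<omega> \<in> space M. X \<omega> = x} \<omega>)" .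
  qed simp
  also have "\<dots> = (\<Sum>x\<in>I. h x * prob {\<omega> \<in> space M. X \<omega> = x})"
    using sets by (subst Bochner_Integration.integral_sum) (auto simp: emeasure_eq_measure)
  finally show ?thesis .
qed

text \<open>The law of \<open>S\<close> gives equal probability to sets of equal cardinality, and
  exchanging \<open>i\<close> with \<open>j\<close> permutes \<open>Pow I\<close> while preserving
  cardinality.\<close>

lemma expectation_random_set_exchangeable:
  fixes h :: "nat \<Rightarrow> real"
  assumes "finite I" and S: "S \<in> measurable M (count_space (Pow I))"
    and p: "\<And>i. i \<in> I \<Longrightarrow> prob {\<omega> \<in> space M. i \<in> S \<omega>} = p"
    and ind: "indep_events (\<lambda>i. {\<omega> \<in> space M. i \<in> S \<omega>}) I"
    and ij: "i \<in> I" "j \<in> I"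
  shows "expectation (\<lambda>\<omega>. if i \<in> S \<omega> then h (card (S \<omega>)) else 0)
    = expectation (\<lambda>\<omega>. if j \<in> S \<omega> then h (card (S \<omega>)) else 0)"
proof -
  define t where "t = Transposition.transpose i j"
  have t: "t ` t ` T = T" "card (t ` T) = card T" "i \<in> t ` T \<longleftrightarrow> j \<in> T" "j \<in> t ` T \<longleftrightarrow> i \<in> T" for T
    by (auto simp: t_def image_image card_image in_transpose_image_iff)
  have tI: "t ` T \<subseteq> I" if "T \<subseteq> I" for T
    using that ij by (auto simp: t_def Transposition.transpose_def)
  have "I \<noteq> {}" using ij by auto
  have law: "prob {\<omega> \<in> space M. S \<omega> = T} = p ^ card T * (1 - p) ^ (card I - card T)" if "T \<in> Pow I" for T
    using that by (intro prob_random_set_eq[OF \<open>finite I\<close> \<open>I \<noteq> {}\<close> S p ind]) auto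
  note eq = expectation_finite_range[OF finite_Pow_iff[THEN iffD2, OF \<open>finite I\<close>] S]
  show ?thesis
    unfolding eq[where h = "\<lambda>T. if i \<in> T then h (card T) else 0"]
      eq[where h = "\<lambda>T. if j \<in> T then h (card T) else 0"]
    by (rule sum.reindex_bij_witness[of _ "image t" "image t"]) (use t tI law in auto)
qed

end

section \<open>Sources of randomness in the DZOFL iteration\<close>

context dzofl
begin

definition source_events :: "source \<Rightarrow> 'w set set" where
  "source_events s = (case s of
      Pert k \<Rightarrow> sets (vimage_algebra (space M) (\<Phi> k) borel)
    | Data k \<Rightarrow> sets (vimage_algebra (space M) (sample_vector N \<xi> k) (\<Pi>\<^sub>M i\<in>{1..N}. D i))
    | Recv k \<Rightarrow> sets (vimage_algebra (space M) (S k) (count_space (Pow {1..N})))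
    | DevNoise i k \<Rightarrow> sets (vimage_algebra (space M) (V i k) U)
    | SrvNoise k \<Rightarrow> sets (vimage_algebra (space M) (W k) U))"

definition sources :: "source set" where
  "sources = range Pert \<union> range Data \<union> range Recv \<union> {DevNoise i k | i k. i \<in> {1..N}} \<union> range SrvNoise"

text \<open>Measurability with respect to this algebra expresses that a variable depends only on the
  sources in \<open>A\<close>.\<close>

definition source_algebra :: "source set \<Rightarrow> 'w measure" where
  "source_algebra A = sigma (space M) (\<Union>s\<in>A. source_events s)"

lemma indep_source_events: "indep_sets source_events sources"
  using sources_indep unfolding source_events_def[abs_def] sources_def .

lemma source_events_subset: "s \<in> sources \<Longrightarrow> source_events s \<subseteq> events"
  using indep_source_events unfolding indep_sets_def by blast

lemma Int_stable_source_events: "Int_stable (source_events s)"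
  by (cases s) (auto simp: source_events_def intro: sets.Int_stable)

lemma UN_source_events_Pow: "(\<Union>s\<in>A. source_events s) \<subseteq> Pow (space M)"
proof -
  have "source_events s \<subseteq> Pow (space M)" for s
    using sets.sets_into_space by (cases s) (fastforce simp: source_events_def)+
  then show ?thesis by blast
qed

lemma space_source_algebra [simp]: "space (source_algebra A) = space M"
  using UN_source_events_Pow[of A] by (simp add: source_algebra_def space_measure_of)

lemma sets_source_algebra:
  "sets (source_algebra A) = sigma_sets (space M) (\<Union>s\<in>A. source_events s)"
  using UN_source_events_Pow[of A] by (simp add: source_algebra_def sets_measure_of)

lemma measurable_source_algebra_mono:
  assumes "X \<in> measurable (source_algebra A) K" "A \<subseteq> B"
  shows "X \<in> measurable (source_algebra B) K"
proof (rule measurable_from_subalg[OF _ assms(1)])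
  show "subalgebra (source_algebra B) (source_algebra A)"
    unfolding subalgebra_def sets_source_algebra
    using assms(2) by (intro conjI sigma_sets_mono') auto
qed

lemma random_variable_source_algebra:
  assumes "X \<in> measurable (source_algebra A) K" "A \<subseteq> sources"
  shows "X \<in> measurable M K"
proof (rule measurable_from_subalg[OF _ assms(1)])
  show "subalgebra M (source_algebra A)"
    unfolding subalgebra_def sets_source_algebra using assms(2) source_events_subset
    by (intro conjI sets.sigma_sets_subset) auto
qed

text \<open>Collecting independent intersection-stable families into two disjoint blocks preserves
  independence. Every later independence claim thereby becomes a disjointness check on sets of
  labels.\<close>

lemma joint_distr_of_disjoint_sources:
  assumes X: "X \<in> measurable (source_algebra A) K" and Y: "Y \<in> measurable (source_algebra B) L"
    and AB: "A \<subseteq> sources" "B \<subseteq> sources" "A \<inter> B = {}"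
  shows "distr M (K \<Otimes>\<^sub>M L) (\<lambda>\<omega>. (X \<omega>, Y \<omega>)) = distr M K X \<Otimes>\<^sub>M distr M L Y"
proof (rule distr_pair_of_indep_set)
  \<comment> \<open>The two blocks are indexed by \<open>bool\<close> because
    \<open>indep_set\<close> is defined as independence of a family over
    \<open>bool\<close>.\<close>
  have "indep_sets (\<lambda>b. sigma_sets (space M) (\<Union>s\<in>(case b of True \<Rightarrow> A | False \<Rightarrow> B). source_events s)) UNIV"
  proof (rule indep_sets_collect_sigma)
    show "indep_sets source_events (\<Union>b\<in>UNIV. case b of True \<Rightarrow> A | False \<Rightarrow> B)"
      by (rule indep_sets_mono_index[OF _ indep_source_events])
        (use AB in \<open>auto split: bool.splits\<close>)
    show "disjoint_family_on (case_bool A B) UNIV"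
      using AB(3) by (auto simp: disjoint_family_on_def split: bool.splits)
  qed (rule Int_stable_source_events)
  then show "indep_set (sets (source_algebra A)) (sets (source_algebra B))"
    unfolding indep_set_def sets_source_algebra
    by (rule indep_sets_cong[THEN iffD1, rotated 2]) (auto split: bool.splits)
  show "X \<in> measurable M K" "Y \<in> measurable M L"
    using X Y AB by (auto intro: random_variable_source_algebra)
  show "X -` a \<inter> space M \<in> sets (source_algebra A)" if "a \<in> sets K" for a
    using measurable_sets[OF X that] by simp
  show "Y -` b \<inter> space M \<in> sets (source_algebra B)" if "b \<in> sets L" for b
    using measurable_sets[OF Y that] by simp
qed

section \<open>Measurability of the individual sources\<close>

lemma measurable_source:
  assumes "s \<in> A" and eq: "source_events s = sets (vimage_algebra (space M) X K)"
    and X: "X \<in> measurable M K"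
  shows "X \<in> measurable (source_algebra A) K"
proof (rule measurable_from_subalg)
  show "X \<in> measurable (vimage_algebra (space M) X K) K"
    using measurable_space[OF X] by (intro measurable_vimage_algebra1) auto
  show "subalgebra (source_algebra A) (vimage_algebra (space M) X K)"
    unfolding subalgebra_def sets_source_algebra eq[symmetric]
    using \<open>s \<in> A\<close> by (auto intro: sigma_sets.Basic)
qed

lemma \<Phi>_source: "Pert k \<in> A \<Longrightarrow> \<Phi> k \<in> borel_measurable (source_algebra A)"
  by (rule measurable_source[OF _ _ \<Phi>_measurable, where s = "Pert k"]) (simp_all add: source_events_def)

lemma S_source: "Recv k \<in> A \<Longrightarrow> S k \<in> measurable (source_algebra A) (count_space (Pow {1..N}))"
  by (rule measurable_source[OF _ _ S_measurable, where s = "Recv k"]) (simp_all add: source_events_def)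

lemma V_source:
  "i \<in> {1..N} \<Longrightarrow> DevNoise i k \<in> A \<Longrightarrow> V i k \<in> measurable (source_algebra A) U"
  by (rule measurable_source[OF _ _ V_measurable, where s = "DevNoise i k"]) (simp_all add: source_events_def)

lemma W_source: "SrvNoise k \<in> A \<Longrightarrow> W k \<in> measurable (source_algebra A) U"
  by (rule measurable_source[OF _ _ W_measurable, where s = "SrvNoise k"]) (simp_all add: source_events_def)

lemma sample_vector_measurable:
  "sample_vector N \<xi> k \<in> measurable M (\<Pi>\<^sub>M i\<in>{1..N}. D i)"
  by (intro measurable_restrict \<xi>_measurable)

lemma \<xi>_source:
  assumes i: "i \<in> {1..N}" and A: "Data k \<in> A"
  shows "\<xi> i k \<in> measurable (source_algebra A) (D i)"
proof -
  have "sample_vector N \<xi> k \<in> measurable (source_algebra A) (\<Pi>\<^sub>M i\<in>{1..N}. D i)"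
    by (rule measurable_source[OF A _ sample_vector_measurable]) (simp add: source_events_def)
  from measurable_compose[OF this measurable_component_singleton[OF i]]
  show ?thesis using i by simp
qed

text \<open>The labels of all randomness drawn before iteration \<open>k\<close>; the sources of
  iteration \<open>k\<close> itself lie outside. For \<open>DevNoise\<close> the iteration number is
  the second argument.\<close>

definition past :: "nat \<Rightarrow> source set" where
  "past k = {s \<in> sources. (case s of Pert j \<Rightarrow> j | Data j \<Rightarrow> j | Recv j \<Rightarrow> j
      | DevNoise i j \<Rightarrow> j | SrvNoise j \<Rightarrow> j) < k}"

section \<open>Reception weights of the devices\<close>

definition weight :: "nat \<Rightarrow> nat set \<Rightarrow> real" where
  "weight i T = (if i \<in> T then real N / real (card T) else 0)"

text \<open>A set containing \<open>i\<close> has between 1 and \<open>N\<close> elements, so the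
  quotient lies between 1 and \<open>N\<close>. The lower bound by the membership indicator is what
  later produces the factor \<open>p\<close>.\<close>

lemma weight_bounds:
  assumes "T \<subseteq> {1..N}"
  shows "0 \<le> weight i T" "weight i T \<le> real N" "of_bool (i \<in> T) \<le> weight i T"
proof -
  have "finite T" using assms by (rule finite_subset) simp
  then have "1 \<le> card T" if "i \<in> T"
    using that by (simp add: Suc_le_eq card_gt_0_iff) blast
  moreover have "card T \<le> N"
    using card_mono[OF _ assms] by simp
  ultimately show "0 \<le> weight i T" "weight i T \<le> real N" "of_bool (i \<in> T) \<le> weight i T"
    by (auto simp: weight_def field_simps mult_le_cancel_left1)
qed

lemma weight_S_measurable: "(\<lambda>\<omega>. weight i (S k \<omega>)) \<in> borel_measurable M"
  by (rule measurable_compose[OF S_measurable]) simp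

lemma S_subset: "\<omega> \<in> space M \<Longrightarrow> S k \<omega> \<subseteq> {1..N}"
  using measurable_space[OF S_measurable] by auto

text \<open>A sum over a random index set becomes one over a fixed set, so that expectations can be
  taken term by term. All weights vanish when \<open>S k \<omega>\<close> is empty, in agreement
  with the default value of \<open>\<Delta>\<close>.\<close>

lemma \<Delta>_eq_weighted_sum:
  assumes "\<omega> \<in> space M"
  shows "\<Delta> k \<omega> = (\<Sum>i\<in>{1..N}. weight i (S k \<omega>) * Q (\<delta> i k \<omega>) (V i k \<omega>))"
proof -
  have "finite (S k \<omega>)"
    using S_subset[OF assms] by (rule finite_subset) simp
  have "(\<Sum>i\<in>{1..N}. weight i (S k \<omega>) * Q (\<delta> i k \<omega>) (V i k \<omega>))
      = (\<Sum>i\<in>{1..N} \<inter> S k \<omega>. real N / real (card (S k \<omega>)) * Q (\<delta> i k \<omega>) (V i k \<omega>))"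
    unfolding weight_def by (subst sum.inter_restrict) (auto intro: sum.cong)
  also have "{1..N} \<inter> S k \<omega> = S k \<omega>"
    using S_subset[OF assms] by blast
  finally show ?thesis
    using \<open>finite (S k \<omega>)\<close> by (simp add: \<Delta>_eq[OF assms] sum_distrib_left)
qed

text \<open>The factor by which packet reception scales the drift; device 1 represents all devices
  by exchangeability. Since the weights add up to \<open>N\<close> on nonempty sets, its value is
  \<open>1 - (1 - p) ^ N\<close>.\<close>

definition mean_weight :: "nat \<Rightarrow> real" where
  "mean_weight k = expectation (\<lambda>\<omega>. weight 1 (S k \<omega>))"

lemma expectation_weight:
  assumes "i \<in> {1..N}"
  shows "expectation (\<lambda>\<omega>. weight i (S k \<omega>)) = mean_weight k"
  unfolding mean_weight_def weight_def
  using expectation_random_set_exchangeable[OF _ S_measurable S_prob S_indep assms, of 1 k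
      "\<lambda>n. real N / real n"] N_pos by simp

lemma mean_weight_bounds: "p \<le> mean_weight k" "mean_weight k \<le> real N"
proof -
  have int: "integrable M (\<lambda>\<omega>. weight 1 (S k \<omega>))"
    using weight_bounds[OF S_subset]
    by (intro integrable_const_bound[of _ "real N"] weight_S_measurable AE_I2) auto
  have sets: "{\<omega> \<in> space M. 1 \<in> S k \<omega>} \<in> events"
    using S_indep[of k] N_pos unfolding indep_events_def by auto
  have "p = expectation (indicator {\<omega> \<in> space M. 1 \<in> S k \<omega>})"
    using S_prob[of 1 k] N_pos sets by simp
  also have "\<dots> \<le> mean_weight k"
    unfolding mean_weight_def using int sets weight_bounds(3)[OF S_subset, of _ 1]
    by (intro integral_mono) (auto simp: indicator_def emeasure_eq_measure)
  finally show "p \<le> mean_weight k" .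
  have "mean_weight k \<le> expectation (\<lambda>_. real N)"
    unfolding mean_weight_def using int weight_bounds(2)[OF S_subset]
    by (intro integral_mono) auto
  then show "mean_weight k \<le> real N"
    by (simp add: prob_space)
qed

end

section \<open>Moments of the stochastic gradient\<close>

text \<open>Collects the regularity, quantizer and perturbation hypotheses with their constants; the
  minimizer and the summability of the step sizes are premises of the concluding lemmas. In this
  locale \<open>'a\<close> is the type of outcomes and \<open>'b\<close> that of samples.\<close>

locale dzofl_smooth = dzofl +
  fixes \<alpha>1 \<alpha>2 \<alpha>3 L\<xi> \<sigma> :: real and L :: "nat \<Rightarrow> 'b \<Rightarrow> real"
  assumes grad_exists: "i \<in> {1..N} \<Longrightarrow> has_gradient_at (local_objective D f i) t"
    and hess_exists: "i \<in> {1..N} \<Longrightarrow> gradient (local_objective D f i) differentiable (at t)"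
    and \<alpha>1_pos: "0 < \<alpha>1"
    and hess_bound: "i \<in> {1..N} \<Longrightarrow> onorm ((*v) (hessian (local_objective D f i) t)) \<le> \<alpha>1"
    and L_measurable: "i \<in> {1..N} \<Longrightarrow> L i \<in> borel_measurable (D i)"
    and lipschitz: "i \<in> {1..N} \<Longrightarrow> x \<in> space (D i) \<Longrightarrow> \<bar>f i t x - f i t' x\<bar> \<le> L i x * norm (t - t')"
    and L_second_moment: "AE \<omega> in M.
      (MAX i\<in>{1..N}. nn_cond_exp M (history M N D \<xi> \<theta> k) (\<lambda>\<omega>. ennreal ((L i (\<xi> i k \<omega>))\<^sup>2)) \<omega>)
        = ennreal L\<xi>"
    and f_integrable: "i \<in> {1..N} \<Longrightarrow> integrable (D i) (f i t)"
    and steps_pos: "0 < \<alpha> k" "0 < \<gamma> k"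
    and Q_unbiased: "quantizer_unbiased U Q"
    and \<sigma>_pos: "0 < \<sigma>"
    and Q_variance: "quantizer_variance_bound U Q \<sigma>"
    and \<Phi>_uncorrelated: "j \<noteq> j' \<Longrightarrow> (\<integral>\<omega>. \<Phi> k \<omega> $ j * \<Phi> k \<omega> $ j' \<partial>M) = 0"
    and \<alpha>2_pos: "0 < \<alpha>2"
    and \<Phi>_second_moment: "(\<integral>\<omega>. (\<Phi> k \<omega> $ j)\<^sup>2 \<partial>M) = \<alpha>2"
    and \<alpha>3_pos: "0 < \<alpha>3"
    and \<Phi>_bounded: "AE \<omega> in M. norm (\<Phi> k \<omega>) \<le> \<alpha>3"
begin

section \<open>Smoothness of the global objective\<close>

abbreviation F_local where "F_local \<equiv> local_objective D f"
abbreviation F where "F \<equiv> global_objective N D f"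
abbreviation gradF where "gradF \<equiv> gradient F"

definition smoothness :: real where "smoothness = real N * \<alpha>1"

lemma smoothness_nonneg: "0 \<le> smoothness"
  using \<alpha>1_pos by (simp add: smoothness_def)

lemma GDERIV_F_local: "i \<in> {1..N} \<Longrightarrow> GDERIV (F_local i) t :> gradient (F_local i) t"
  by (intro GDERIV_gradient grad_exists)

lemma gradF_eq_sum: "gradF t = (\<Sum>i\<in>{1..N}. gradient (F_local i) t)"
  and GDERIV_F: "GDERIV F t :> gradF t"
proof -
  have G: "GDERIV F t :> (\<Sum>i\<in>{1..N}. gradient (F_local i) t)"
    unfolding global_objective_def[abs_def] by (intro GDERIV_sum GDERIV_F_local)
  then show eq: "gradF t = (\<Sum>i\<in>{1..N}. gradient (F_local i) t)"
    by (rule gradient_eqI)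
  show "GDERIV F t :> gradF t"
    using G unfolding eq .
qed

lemma gradF_lipschitz: "norm (gradF s - gradF t) \<le> smoothness * norm (s - t)"
proof -
  have "norm (gradF s - gradF t) = norm (\<Sum>i\<in>{1..N}. gradient (F_local i) s - gradient (F_local i) t)"
    by (simp add: gradF_eq_sum sum_subtractf)
  also have "\<dots> \<le> (\<Sum>i\<in>{1..N}. \<alpha>1 * norm (s - t))"
    by (intro sum_norm_le gradient_lipschitz_of_hessian_bound hess_exists hess_bound)
  finally show ?thesis by (simp add: smoothness_def)
qed

lemma F_linearization: "\<bar>F t - F s - (t - s) \<bullet> gradF s\<bar> \<le> smoothness * (norm (t - s))\<^sup>2"
  using GDERIV_F gradF_lipschitz smoothness_nonneg by (rule smooth_linearization_bound)

lemma F_local_measurable [measurable]: "i \<in> {1..N} \<Longrightarrow> F_local i \<in> borel_measurable borel"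
  using GDERIV_F_local[of i] unfolding gderiv_def
  by (intro borel_measurable_continuous_onI)
    (auto simp: continuous_on_eq_continuous_at intro: has_derivative_continuous)

lemma F_measurable [measurable]: "F \<in> borel_measurable borel"
  unfolding global_objective_def[abs_def] by measurable

lemma gradF_measurable [measurable]: "gradF \<in> borel_measurable borel"
proof (rule borel_measurable_continuous_onI)
  have "smoothness-lipschitz_on UNIV gradF"
    using gradF_lipschitz smoothness_nonneg by (intro lipschitz_onI) (auto simp: dist_norm)
  then show "continuous_on UNIV gradF"
    by (rule lipschitz_on_continuous_on)
qed

text \<open>The Lipschitz inequality between a unit vector and the origin forces the sign.\<close>

lemma L_nonneg: "i \<in> {1..N} \<Longrightarrow> x \<in> space (D i) \<Longrightarrow> 0 \<le> L i x"
  using order_trans[OF abs_ge_zero lipschitz[of i x "axis undefined 1" 0]] by simp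

text \<open>Measurability is given for each fixed parameter, and the Lipschitz bound supplies
  continuity in the parameter, so \<open>f i\<close> is a Caratheodory function.\<close>

lemma f_joint_measurable:
  assumes "i \<in> {1..N}"
  shows "(\<lambda>(t, x). f i t x) \<in> borel_measurable (borel \<Otimes>\<^sub>M D i)"
proof (rule borel_measurable_Caratheodory)
  fix x assume "x \<in> space (D i)"
  then have "(L i x)-lipschitz_on UNIV (\<lambda>t. f i t x)"
    using lipschitz[OF assms] L_nonneg[OF assms] by (intro lipschitz_onI) (auto simp: dist_norm)
  then show "continuous_on UNIV (\<lambda>t. f i t x)"
    by (rule lipschitz_on_continuous_on)
qed (rule f_measurable[OF assms])

lemma Q_joint_measurable: "(\<lambda>(x, u). Q x u) \<in> borel_measurable (borel \<Otimes>\<^sub>M U)"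
  using quantizer by (simp add: random_quantizer_def)

section \<open>Adaptedness of the iterates\<close>

lemma past_subset: "past k \<subseteq> sources"
  by (auto simp: past_def)

lemma fresh_sources:
  "Pert k \<in> sources - past k" "Data k \<in> sources - past k" "Recv k \<in> sources - past k"
  "i \<in> {1..N} \<Longrightarrow> DevNoise i k \<in> sources - past k" "SrvNoise k \<in> sources - past k"
  by (auto simp: past_def sources_def)

lemma past_Suc:
  "past (Suc k) = past k \<union> {Pert k, Data k, Recv k, SrvNoise k} \<union> (\<lambda>i. DevNoise i k) ` {1..N}"
  by (auto simp: past_def sources_def less_Suc_eq split: source.splits)

lemma measurable_f_comp:
  assumes i: "i \<in> {1..N}"
    and X: "X \<in> borel_measurable K" and Y: "Y \<in> measurable K (D i)"
  shows "(\<lambda>\<omega>. f i (X \<omega>) (Y \<omega>)) \<in> borel_measurable K"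
  using measurable_compose[OF measurable_Pair[OF X Y] f_joint_measurable[OF i]] by simp

lemma measurable_Q_comp:
  assumes X: "X \<in> borel_measurable K" and Y: "Y \<in> measurable K U"
  shows "(\<lambda>\<omega>. Q (X \<omega>) (Y \<omega>)) \<in> borel_measurable K"
  using measurable_compose[OF measurable_Pair[OF X Y] Q_joint_measurable] by simp

lemma \<delta>_source_measurable:
  assumes \<theta>: "\<theta> k \<in> borel_measurable (source_algebra A)"
    and A: "Pert k \<in> A" "Data k \<in> A" and i: "i \<in> {1..N}"
  shows "\<delta> i k \<in> borel_measurable (source_algebra A)"
proof -
  note [measurable] = \<theta> \<Phi>_source[OF A(1)] \<xi>_source[OF i A(2)]
  have "(\<lambda>\<omega>. f i (\<theta> k \<omega> + \<gamma> k *\<^sub>R \<Phi> k \<omega>) (\<xi> i k \<omega>) - f i (\<theta> k \<omega> - \<gamma> k *\<^sub>R \<Phi> k \<omega>) (\<xi> i k \<omega>))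
      \<in> borel_measurable (source_algebra A)"
    by (intro borel_measurable_diff measurable_f_comp[OF i]) measurable
  then show ?thesis
    by (subst measurable_cong[OF \<delta>_eq[OF _ i]]) simp_all
qed

lemma \<Delta>_source_measurable:
  assumes \<theta>: "\<theta> k \<in> borel_measurable (source_algebra A)"
    and A: "Pert k \<in> A" "Data k \<in> A" "Recv k \<in> A" "\<And>i. i \<in> {1..N} \<Longrightarrow> DevNoise i k \<in> A"
  shows "\<Delta> k \<in> borel_measurable (source_algebra A)"
proof -
  have "(\<lambda>\<omega>. \<Sum>i\<in>{1..N}. weight i (S k \<omega>) * Q (\<delta> i k \<omega>) (V i k \<omega>))
      \<in> borel_measurable (source_algebra A)"
    by (intro borel_measurable_sum borel_measurable_times measurable_Q_comp
        \<delta>_source_measurable[OF \<theta>] V_source A measurable_compose[OF S_source]) simp_all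
  then show ?thesis
    by (subst measurable_cong[OF \<Delta>_eq_weighted_sum]) simp_all
qed

text \<open>Unfolding the recursion, the iterate is a function of the sources of earlier iterations.
  Hence it is independent of everything drawn at iteration \<open>k\<close>.\<close>

lemma \<theta>_source_measurable: "\<theta> k \<in> borel_measurable (source_algebra (past k))"
proof (induction k)
  case 0
  show ?case
    by (subst measurable_cong[OF \<theta>_0]) simp_all
next
  case (Suc k)
  let ?A = "past (Suc k)"
  have \<theta>_k [measurable]: "\<theta> k \<in> borel_measurable (source_algebra ?A)"
    using Suc by (rule measurable_source_algebra_mono) (auto simp: past_Suc)
  have [measurable]: "\<Phi> k \<in> borel_measurable (source_algebra ?A)"
    "W k \<in> measurable (source_algebra ?A) U"
    by (auto intro!: \<Phi>_source W_source simp: past_Suc)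
  have [measurable]: "\<Delta> k \<in> borel_measurable (source_algebra ?A)"
    by (rule \<Delta>_source_measurable[OF \<theta>_k]) (auto simp: past_Suc)
  have [measurable]: "(\<lambda>\<omega>. Q (\<Delta> k \<omega>) (W k \<omega>)) \<in> borel_measurable (source_algebra ?A)"
    by (intro measurable_Q_comp) measurable
  have "(\<lambda>\<omega>. \<theta> k \<omega> - \<alpha> k *\<^sub>R (Q (\<Delta> k \<omega>) (W k \<omega>) *\<^sub>R \<Phi> k \<omega>)) \<in> borel_measurable (source_algebra ?A)"
    by measurable
  then show ?case
    by (subst measurable_cong[where g = "\<lambda>\<omega>. \<theta> k \<omega> - \<alpha> k *\<^sub>R (Q (\<Delta> k \<omega>) (W k \<omega>) *\<^sub>R \<Phi> k \<omega>)"])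
      (simp_all add: \<theta>_Suc g_eq)
qed

lemma \<theta>_measurable [measurable]: "\<theta> k \<in> borel_measurable M"
  using \<theta>_source_measurable past_subset by (rule random_variable_source_algebra)

lemma \<delta>_measurable: "i \<in> {1..N} \<Longrightarrow> \<delta> i k \<in> borel_measurable M"
  by (rule random_variable_source_algebra[OF \<delta>_source_measurable[OF
      measurable_source_algebra_mono[OF \<theta>_source_measurable], of k "past k \<union> {Pert k, Data k}"]])
    (use past_subset fresh_sources in auto)

lemma \<Delta>_measurable [measurable]: "\<Delta> k \<in> borel_measurable M"
  by (rule random_variable_source_algebra[OF \<Delta>_source_measurable[OF
      measurable_source_algebra_mono[OF \<theta>_source_measurable], of k sources]])
    (use past_subset fresh_sources in auto)

declare \<Phi>_measurable [measurable] W_measurable [measurable] weight_S_measurable [measurable]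

lemma Q_V_measurable: "i \<in> {1..N} \<Longrightarrow> (\<lambda>\<omega>. Q (\<delta> i k \<omega>) (V i k \<omega>)) \<in> borel_measurable M"
  by (intro measurable_Q_comp \<delta>_measurable V_measurable)

lemma Q_W_measurable [measurable]: "(\<lambda>\<omega>. Q (\<Delta> k \<omega>) (W k \<omega>)) \<in> borel_measurable M"
  by (intro measurable_Q_comp \<Delta>_measurable W_measurable)

lemma g_measurable [measurable]: "g k \<in> borel_measurable M"
proof -
  have "(\<lambda>\<omega>. Q (\<Delta> k \<omega>) (W k \<omega>) *\<^sub>R \<Phi> k \<omega>) \<in> borel_measurable M"
    by measurable
  then show ?thesis
    by (subst measurable_cong[OF g_eq]) simp_all
qed

text \<open>The history is a sub-sigma-algebra, so that integrating the conditional second moment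
  yields the unconditional one.\<close>
lemma L_second_moment_le:
  assumes i: "i \<in> {1..N}"
  shows "(\<integral>\<^sup>+\<omega>. ennreal ((L i (\<xi> i k \<omega>))\<^sup>2) \<partial>M) \<le> ennreal L\<xi>"
proof -
  let ?H = "history M N D \<xi> \<theta> k"
  let ?gen = "(\<Union>j\<in>{..k}. sets (vimage_algebra (space M) (\<theta> j) borel)) \<union>
      (\<Union>j\<in>{..<k}. sets (vimage_algebra (space M) (sample_vector N \<xi> j) (\<Pi>\<^sub>M i\<in>{1..N}. D i)))"
  have gen: "?gen \<subseteq> events"
    using sets_image_in_sets[OF refl \<theta>_measurable] sets_image_in_sets[OF refl sample_vector_measurable]
    by blast
  have "?gen \<subseteq> Pow (space M)"
    using gen sets.space_closed by blast
  then have "subalgebra M ?H"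
    using gen unfolding subalgebra_def history_def
    by (simp add: space_measure_of sets_measure_of sets.sigma_sets_subset)
  then interpret H: finite_measure_subalgebra M ?H
    by unfold_locales
  have [measurable]: "\<xi> i k \<in> measurable M (D i)" "L i \<in> borel_measurable (D i)"
    using i by (auto intro: \<xi>_measurable L_measurable)
  \<comment> \<open>Tower property, obtained with the constant 1 as test function.\<close>
  have "(\<integral>\<^sup>+\<omega>. ennreal ((L i (\<xi> i k \<omega>))\<^sup>2) \<partial>M)
      = (\<integral>\<^sup>+\<omega>. nn_cond_exp M ?H (\<lambda>\<omega>. ennreal ((L i (\<xi> i k \<omega>))\<^sup>2)) \<omega> \<partial>M)"
    using H.nn_cond_exp_intg[of "\<lambda>_. 1" "\<lambda>\<omega>. ennreal ((L i (\<xi> i k \<omega>))\<^sup>2)"] by simp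
  also have "\<dots> \<le> (\<integral>\<^sup>+\<omega>. ennreal L\<xi> \<partial>M)"
  proof (rule nn_integral_mono_AE)
    show "AE \<omega> in M. nn_cond_exp M ?H (\<lambda>\<omega>. ennreal ((L i (\<xi> i k \<omega>))\<^sup>2)) \<omega> \<le> ennreal L\<xi>"
      using L_second_moment[of k]
    proof eventually_elim
      case (elim \<omega>)
      show ?case
        unfolding elim[symmetric] using i by (intro Max_ge) auto
    qed
  qed
  finally show ?thesis by (simp add: emeasure_space_1)
qed

text \<open>Bias-variance decomposition: as \<open>Q x\<close> has mean \<open>x\<close>, its second
  moment is its variance plus \<open>x\<^sup>2\<close>.\<close>

lemma Q_second_moment:
  "integrable U (\<lambda>u. (Q x u)\<^sup>2)" "(\<integral>u. (Q x u)\<^sup>2 \<partial>U) \<le> (1 + \<sigma>) * x\<^sup>2"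
proof -
  interpret U: prob_space U
    using quantizer by (simp add: random_quantizer_def)
  have 1: "integrable U (Q x)" "(\<integral>u. Q x u \<partial>U) = x"
    using Q_unbiased by (auto simp: quantizer_unbiased_def)
  have 2: "integrable U (\<lambda>u. (Q x u - x)\<^sup>2)" "(\<integral>u. (Q x u - x)\<^sup>2 \<partial>U) \<le> \<sigma> * x\<^sup>2"
    using Q_variance by (auto simp: quantizer_variance_bound_def)
  have eq: "(Q x u)\<^sup>2 = (Q x u - x)\<^sup>2 + 2 * x * Q x u - x\<^sup>2" for u
    by (simp add: power2_eq_square algebra_simps)
  show "integrable U (\<lambda>u. (Q x u)\<^sup>2)"
    unfolding eq using 1 2 by simp
  have "(\<integral>u. (Q x u)\<^sup>2 \<partial>U) = (\<integral>u. (Q x u - x)\<^sup>2 \<partial>U) + x\<^sup>2"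
    unfolding eq using 1 2 by (simp add: U.prob_space power2_eq_square)
  with 2 show "(\<integral>u. (Q x u)\<^sup>2 \<partial>U) \<le> (1 + \<sigma>) * x\<^sup>2"
    by (simp add: algebra_simps)
qed

text \<open>The seed is independent of the input, so the bound for a fixed input is integrated over
  the law of the input. Each passage through the quantizer costs a factor
  \<open>1 + \<sigma>\<close>.\<close>

lemma nn_integral_Q_square_le:
  assumes X: "X \<in> borel_measurable (source_algebra A)" and Y: "Y \<in> measurable (source_algebra B) U"
    and AB: "A \<subseteq> sources" "B \<subseteq> sources" "A \<inter> B = {}" and dY: "distr M U Y = U"
    and le: "(\<integral>\<^sup>+\<omega>. ennreal ((X \<omega>)\<^sup>2) \<partial>M) \<le> ennreal K" and "0 \<le> K"
  shows "(\<integral>\<^sup>+\<omega>. ennreal ((Q (X \<omega>) (Y \<omega>))\<^sup>2) \<partial>M) \<le> ennreal ((1 + \<sigma>) * K)"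
proof -
  have [measurable]: "X \<in> borel_measurable M" "Y \<in> measurable M U"
    using X Y AB by (auto intro: random_variable_source_algebra)
  note [measurable] = Q_joint_measurable
  have "(\<integral>\<^sup>+\<omega>. ennreal ((Q (X \<omega>) (Y \<omega>))\<^sup>2) \<partial>M) = (\<integral>\<^sup>+\<omega>. (\<integral>\<^sup>+u. ennreal ((Q (X \<omega>) u)\<^sup>2) \<partial>U) \<partial>M)"
    using nn_integral_joint[OF _ _ joint_distr_of_disjoint_sources[OF X Y AB],
        of "\<lambda>(x, u). ennreal ((Q x u)\<^sup>2)"] by (simp add: dY)
  also have "\<dots> \<le> (\<integral>\<^sup>+\<omega>. ennreal (1 + \<sigma>) * ennreal ((X \<omega>)\<^sup>2) \<partial>M)"
  proof (rule nn_integral_mono)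
    fix \<omega>
    have "(\<integral>\<^sup>+u. ennreal ((Q (X \<omega>) u)\<^sup>2) \<partial>U) \<le> ennreal ((1 + \<sigma>) * (X \<omega>)\<^sup>2)"
      using Q_second_moment by (simp add: nn_integral_eq_integral ennreal_leI)
    then show "(\<integral>\<^sup>+u. ennreal ((Q (X \<omega>) u)\<^sup>2) \<partial>U) \<le> ennreal (1 + \<sigma>) * ennreal ((X \<omega>)\<^sup>2)"
      using \<sigma>_pos by (subst ennreal_mult[symmetric]) auto
  qed
  also have "\<dots> = ennreal (1 + \<sigma>) * (\<integral>\<^sup>+\<omega>. ennreal ((X \<omega>)\<^sup>2) \<partial>M)"
    by (rule nn_integral_cmult) measurable
  also have "\<dots> \<le> ennreal (1 + \<sigma>) * ennreal K"
    using le by (rule mult_left_mono) simp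
  also have "\<dots> = ennreal ((1 + \<sigma>) * K)"
    using \<sigma>_pos \<open>0 \<le> K\<close> by (subst ennreal_mult) auto
  finally show ?thesis .
qed

text \<open>Unbiasedness conditional on the sources in \<open>A\<close>: the pair
  \<open>(Z, X)\<close> is frozen while the seed is integrated out, so the cofactor \<open>Z\<close>
  has to be independent of the seed together with \<open>X\<close>.\<close>

lemma expectation_Q:
  assumes Z: "Z \<in> borel_measurable (source_algebra A)"
    and X: "X \<in> borel_measurable (source_algebra A)" and Y: "Y \<in> measurable (source_algebra B) U"
    and AB: "A \<subseteq> sources" "B \<subseteq> sources" "A \<inter> B = {}" and dY: "distr M U Y = U"
    and int: "integrable M (\<lambda>\<omega>. Z \<omega> * Q (X \<omega>) (Y \<omega>))"
  shows "integrable M (\<lambda>\<omega>. Z \<omega> * X \<omega>)"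
    and "expectation (\<lambda>\<omega>. Z \<omega> * Q (X \<omega>) (Y \<omega>)) = expectation (\<lambda>\<omega>. Z \<omega> * X \<omega>)"
proof -
  have ZX: "(\<lambda>\<omega>. (Z \<omega>, X \<omega>)) \<in> measurable (source_algebra A) (borel \<Otimes>\<^sub>M borel)"
    using Z X by measurable
  have meas: "(\<lambda>\<omega>. (Z \<omega>, X \<omega>)) \<in> measurable M (borel \<Otimes>\<^sub>M borel)" "Y \<in> measurable M U"
    using ZX Y AB by (auto intro: random_variable_source_algebra)
  have h: "(\<lambda>((z, x), u). z * Q x u) \<in> borel_measurable ((borel \<Otimes>\<^sub>M borel) \<Otimes>\<^sub>M U)"
    unfolding case_prod_beta
    by (intro borel_measurable_times measurable_Q_comp) measurable
  have mean: "integral\<^sup>L U (Q x) = x" for x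
    using Q_unbiased by (simp add: quantizer_unbiased_def)
  note J = integral_joint[OF meas joint_distr_of_disjoint_sources[OF ZX Y AB] h]
  show "integrable M (\<lambda>\<omega>. Z \<omega> * X \<omega>)"
    "expectation (\<lambda>\<omega>. Z \<omega> * Q (X \<omega>) (Y \<omega>)) = expectation (\<lambda>\<omega>. Z \<omega> * X \<omega>)"
    using J int by (simp_all add: dY mean)
qed

text \<open>\<open>L\<xi>\<close> enters the hypotheses through \<open>ennreal\<close>, which sends
  negative reals to 0; the maximum makes the real constant agree with that.\<close>

definition L_moment :: real where "L_moment = max L\<xi> 0"

text \<open>The two query points differ by \<open>2 * \<gamma> k\<close> times
  \<open>\<Phi> k\<close>, so the difference is at most the random Lipschitz constant times
  \<open>2 * \<gamma> k * \<alpha>3\<close>. This is the origin of the factor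
  \<open>(\<gamma> k)\<^sup>2\<close> in all later moments.\<close>

lemma nn_integral_\<delta>_square_le:
  assumes i: "i \<in> {1..N}"
  shows "(\<integral>\<^sup>+\<omega>. ennreal ((\<delta> i k \<omega>)\<^sup>2) \<partial>M) \<le> ennreal (4 * (\<gamma> k)\<^sup>2 * \<alpha>3\<^sup>2 * L_moment)"
proof -
  have [measurable]: "\<xi> i k \<in> measurable M (D i)" "L i \<in> borel_measurable (D i)"
    using i by (auto intro: \<xi>_measurable L_measurable)
  have "AE \<omega> in M. ennreal ((\<delta> i k \<omega>)\<^sup>2)
      \<le> ennreal (4 * (\<gamma> k)\<^sup>2 * \<alpha>3\<^sup>2) * ennreal ((L i (\<xi> i k \<omega>))\<^sup>2)"
    using \<Phi>_bounded[of k] AE_space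
  proof eventually_elim
    case (elim \<omega>)
    have x: "\<xi> i k \<omega> \<in> space (D i)"
      using measurable_space[OF \<xi>_measurable[OF i] elim(2)] .
    have "\<bar>\<delta> i k \<omega>\<bar> \<le> L i (\<xi> i k \<omega>) * norm ((2 * \<gamma> k) *\<^sub>R \<Phi> k \<omega>)"
      using lipschitz[OF i x, of "\<theta> k \<omega> + \<gamma> k *\<^sub>R \<Phi> k \<omega>" "\<theta> k \<omega> - \<gamma> k *\<^sub>R \<Phi> k \<omega>"]
      by (simp add: \<delta>_eq[OF elim(2) i] scaleR_2[symmetric] flip: scaleR_scaleR)
    also have "\<dots> \<le> L i (\<xi> i k \<omega>) * (2 * \<gamma> k * \<alpha>3)"
      using elim(1) steps_pos(2)[of k] L_nonneg[OF i x] by (intro mult_left_mono) auto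
    finally have "\<bar>\<delta> i k \<omega>\<bar>\<^sup>2 \<le> (L i (\<xi> i k \<omega>) * (2 * \<gamma> k * \<alpha>3))\<^sup>2"
      by (intro power_mono) auto
    then have "(\<delta> i k \<omega>)\<^sup>2 \<le> 4 * (\<gamma> k)\<^sup>2 * \<alpha>3\<^sup>2 * (L i (\<xi> i k \<omega>))\<^sup>2"
      by (simp add: power_mult_distrib mult_ac)
    then show ?case
      by (subst ennreal_mult[symmetric]) (auto intro: ennreal_leI)
  qed
  then have "(\<integral>\<^sup>+\<omega>. ennreal ((\<delta> i k \<omega>)\<^sup>2) \<partial>M)
      \<le> (\<integral>\<^sup>+\<omega>. ennreal (4 * (\<gamma> k)\<^sup>2 * \<alpha>3\<^sup>2) * ennreal ((L i (\<xi> i k \<omega>))\<^sup>2) \<partial>M)"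
    by (rule nn_integral_mono_AE)
  also have "\<dots> = ennreal (4 * (\<gamma> k)\<^sup>2 * \<alpha>3\<^sup>2) * (\<integral>\<^sup>+\<omega>. ennreal ((L i (\<xi> i k \<omega>))\<^sup>2) \<partial>M)"
    by (rule nn_integral_cmult) measurable
  also have "\<dots> \<le> ennreal (4 * (\<gamma> k)\<^sup>2 * \<alpha>3\<^sup>2) * ennreal L_moment"
    using L_second_moment_le[OF i, of k]
    by (intro mult_left_mono) (auto simp: L_moment_def intro: order_trans ennreal_leI)
  also have "\<dots> = ennreal (4 * (\<gamma> k)\<^sup>2 * \<alpha>3\<^sup>2 * L_moment)"
    by (subst ennreal_mult) (auto simp: L_moment_def)
  finally show ?thesis .
qed

lemma \<theta>_sources: "past k \<subseteq> A \<Longrightarrow> \<theta> k \<in> borel_measurable (source_algebra A)"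
  using \<theta>_source_measurable by (rule measurable_source_algebra_mono)

lemma nn_integral_Q_V_square_le:
  assumes i: "i \<in> {1..N}"
  shows "(\<integral>\<^sup>+\<omega>. ennreal ((Q (\<delta> i k \<omega>) (V i k \<omega>))\<^sup>2) \<partial>M)
    \<le> ennreal ((1 + \<sigma>) * (4 * (\<gamma> k)\<^sup>2 * \<alpha>3\<^sup>2 * L_moment))"
proof (rule nn_integral_Q_square_le)
  show "\<delta> i k \<in> borel_measurable (source_algebra (past k \<union> {Pert k, Data k}))"
    using i by (intro \<delta>_source_measurable \<theta>_sources) auto
  show "V i k \<in> measurable (source_algebra {DevNoise i k}) U"
    using i by (intro V_source) auto
qed (use past_subset fresh_sources[where k = k] V_distr i nn_integral_\<delta>_square_le
    in \<open>auto simp: L_moment_def\<close>)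

text \<open>Cauchy-Schwarz over the devices: \<open>N\<close> squared weights, each at most
  \<open>(real N)\<^sup>2\<close>, give the factor \<open>real N ^ 3\<close>.\<close>

lemma \<Delta>_square_le:
  assumes "\<omega> \<in> space M"
  shows "(\<Delta> k \<omega>)\<^sup>2 \<le> (\<Sum>i\<in>{1..N}. real N ^ 3 * (Q (\<delta> i k \<omega>) (V i k \<omega>))\<^sup>2)"
proof -
  have "(\<Delta> k \<omega>)\<^sup>2 \<le> (\<Sum>i\<in>{1..N}. (weight i (S k \<omega>))\<^sup>2) * (\<Sum>i\<in>{1..N}. (Q (\<delta> i k \<omega>) (V i k \<omega>))\<^sup>2)"
    unfolding \<Delta>_eq_weighted_sum[OF assms] by (rule Cauchy_Schwarz_ineq_sum)
  also have "\<dots> \<le> (\<Sum>i\<in>{1..N}. (real N)\<^sup>2) * (\<Sum>i\<in>{1..N}. (Q (\<delta> i k \<omega>) (V i k \<omega>))\<^sup>2)"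
    using weight_bounds[OF S_subset[OF assms]]
    by (intro mult_right_mono sum_mono power_mono sum_nonneg) auto
  also have "\<dots> = (\<Sum>i\<in>{1..N}. real N ^ 3 * (Q (\<delta> i k \<omega>) (V i k \<omega>))\<^sup>2)"
    by (simp add: sum_distrib_left power3_eq_cube power2_eq_square mult.assoc)
  finally show ?thesis .
qed

lemma nn_integral_\<Delta>_square_le:
  "(\<integral>\<^sup>+\<omega>. ennreal ((\<Delta> k \<omega>)\<^sup>2) \<partial>M)
    \<le> ennreal (real N ^ 4 * ((1 + \<sigma>) * (4 * (\<gamma> k)\<^sup>2 * \<alpha>3\<^sup>2 * L_moment)))"
proof -
  let ?K = "(1 + \<sigma>) * (4 * (\<gamma> k)\<^sup>2 * \<alpha>3\<^sup>2 * L_moment)"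
  have K: "0 \<le> ?K"
    using \<sigma>_pos by (simp add: L_moment_def)
  have "(\<integral>\<^sup>+\<omega>. ennreal ((\<Delta> k \<omega>)\<^sup>2) \<partial>M)
      \<le> (\<integral>\<^sup>+\<omega>. (\<Sum>i\<in>{1..N}. ennreal (real N ^ 3) * ennreal ((Q (\<delta> i k \<omega>) (V i k \<omega>))\<^sup>2)) \<partial>M)"
  proof (rule nn_integral_mono)
    fix \<omega> assume "\<omega> \<in> space M"
    then show "ennreal ((\<Delta> k \<omega>)\<^sup>2)
        \<le> (\<Sum>i\<in>{1..N}. ennreal (real N ^ 3) * ennreal ((Q (\<delta> i k \<omega>) (V i k \<omega>))\<^sup>2))"
      using \<Delta>_square_le[of \<omega> k]
      by (simp add: ennreal_mult[symmetric] sum_ennreal ennreal_leI del: ennreal_power)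
  qed
  also have "\<dots> = (\<Sum>i\<in>{1..N}. ennreal (real N ^ 3) *
      (\<integral>\<^sup>+\<omega>. ennreal ((Q (\<delta> i k \<omega>) (V i k \<omega>))\<^sup>2) \<partial>M))"
    using Q_V_measurable by (subst nn_integral_sum) (auto intro!: sum.cong nn_integral_cmult)
  also have "\<dots> \<le> (\<Sum>i\<in>{1..N}. ennreal (real N ^ 3) * ennreal ?K)"
    by (intro sum_mono mult_left_mono nn_integral_Q_V_square_le) auto
  also have "\<dots> = (\<Sum>i\<in>{1..N}. ennreal (real N ^ 3 * ?K))"
    using K by (intro sum.cong refl, subst ennreal_mult) auto
  also have "\<dots> = ennreal (\<Sum>i\<in>{1..N}. real N ^ 3 * ?K)"
    using K by (intro sum_ennreal) auto
  also have "(\<Sum>i\<in>{1..N}. real N ^ 3 * ?K) = real N ^ 4 * ?K"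
    by (simp add: power4_eq_xxxx power3_eq_cube mult_ac)
  finally show ?thesis .
qed

lemma nn_integral_Q_W_square_le:
  "(\<integral>\<^sup>+\<omega>. ennreal ((Q (\<Delta> k \<omega>) (W k \<omega>))\<^sup>2) \<partial>M)
    \<le> ennreal ((1 + \<sigma>) * (real N ^ 4 * ((1 + \<sigma>) * (4 * (\<gamma> k)\<^sup>2 * \<alpha>3\<^sup>2 * L_moment))))"
proof (rule nn_integral_Q_square_le)
  show "\<Delta> k \<in> borel_measurable (source_algebra
      (past k \<union> ({Pert k, Data k, Recv k} \<union> (\<lambda>i. DevNoise i k) ` {1..N})))"
    by (intro \<Delta>_source_measurable \<theta>_sources) auto
  show "W k \<in> measurable (source_algebra {SrvNoise k}) U"
    by (intro W_source) auto
qed (use past_subset fresh_sources[where k = k] W_distr nn_integral_\<Delta>_square_le \<sigma>_pos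
    in \<open>auto simp: L_moment_def\<close>)

lemma
  shows integrable_\<delta>_square: "i \<in> {1..N} \<Longrightarrow> integrable M (\<lambda>\<omega>. (\<delta> i k \<omega>)\<^sup>2)"
    and integrable_Q_V_square: "i \<in> {1..N} \<Longrightarrow> integrable M (\<lambda>\<omega>. (Q (\<delta> i k \<omega>) (V i k \<omega>))\<^sup>2)"
    and integrable_Q_W_square: "integrable M (\<lambda>\<omega>. (Q (\<Delta> k \<omega>) (W k \<omega>))\<^sup>2)"
  using \<sigma>_pos \<delta>_measurable Q_V_measurable
  by (auto intro!: integrable_le_of_nn_integral_le(1) simp: L_moment_def
      intro: nn_integral_\<delta>_square_le nn_integral_Q_V_square_le nn_integral_Q_W_square_le)

text \<open>The factors, from the outside in, come from the norm bound on \<open>\<Phi> k\<close>,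
  the server quantizer, Cauchy-Schwarz and summation over the devices, the device quantizer, and the
  squared function difference stripped of \<open>(\<gamma> k)\<^sup>2\<close>.\<close>

definition g_moment :: real where
  "g_moment = \<alpha>3\<^sup>2 * ((1 + \<sigma>) * (real N ^ 4 * ((1 + \<sigma>) * (4 * \<alpha>3\<^sup>2 * L_moment))))"

lemma g_moment_nonneg: "0 \<le> g_moment"
  using \<sigma>_pos by (simp add: g_moment_def L_moment_def)

lemma g_second_moment:
  shows integrable_g_square: "integrable M (\<lambda>\<omega>. (norm (g k \<omega>))\<^sup>2)"
    and "expectation (\<lambda>\<omega>. (norm (g k \<omega>))\<^sup>2) \<le> g_moment * (\<gamma> k)\<^sup>2"
proof -
  let ?K = "(1 + \<sigma>) * (real N ^ 4 * ((1 + \<sigma>) * (4 * (\<gamma> k)\<^sup>2 * \<alpha>3\<^sup>2 * L_moment)))"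
  have le: "AE \<omega> in M. (norm (g k \<omega>))\<^sup>2 \<le> \<alpha>3\<^sup>2 * (Q (\<Delta> k \<omega>) (W k \<omega>))\<^sup>2"
    using \<Phi>_bounded[of k] AE_space
  proof eventually_elim
    case (elim \<omega>)
    then show ?case
      by (auto simp: g_eq power_mult_distrib mult.commute intro!: mult_right_mono power_mono)
  qed
  have K: "0 \<le> ?K"
    using \<sigma>_pos by (simp add: L_moment_def)
  note Q = integrable_le_of_nn_integral_le[OF _ _ nn_integral_Q_W_square_le K]
  show int: "integrable M (\<lambda>\<omega>. (norm (g k \<omega>))\<^sup>2)"
    by (rule Bochner_Integration.integrable_bound[of _ "\<lambda>\<omega>. \<alpha>3\<^sup>2 * (Q (\<Delta> k \<omega>) (W k \<omega>))\<^sup>2"])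
      (use le integrable_Q_W_square in auto)
  have "expectation (\<lambda>\<omega>. (norm (g k \<omega>))\<^sup>2) \<le> expectation (\<lambda>\<omega>. \<alpha>3\<^sup>2 * (Q (\<Delta> k \<omega>) (W k \<omega>))\<^sup>2)"
    using int integrable_Q_W_square le by (intro integral_mono_AE) auto
  also have "\<dots> = \<alpha>3\<^sup>2 * expectation (\<lambda>\<omega>. (Q (\<Delta> k \<omega>) (W k \<omega>))\<^sup>2)"
    by simp
  also have "\<dots> \<le> \<alpha>3\<^sup>2 * ?K"
    by (intro mult_left_mono Q(2)) auto
  also have "\<dots> = g_moment * (\<gamma> k)\<^sup>2"
    by (simp add: g_moment_def mult_ac)
  finally show "expectation (\<lambda>\<omega>. (norm (g k \<omega>))\<^sup>2) \<le> g_moment * (\<gamma> k)\<^sup>2" .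
qed

section \<open>Integrability along the iterates\<close>

lemma integrable_\<theta>_square: "integrable M (\<lambda>\<omega>. (norm (\<theta> k \<omega>))\<^sup>2)"
proof (induction k)
  case 0
  have "integrable M (\<lambda>\<omega>. (norm (\<theta> 0 \<omega>))\<^sup>2) \<longleftrightarrow> integrable M (\<lambda>\<omega>. (norm \<theta>0)\<^sup>2)"
    by (intro Bochner_Integration.integrable_cong) (simp_all add: \<theta>_0)
  then show ?case by simp
next
  case (Suc k)
  have "AE \<omega> in M. norm ((norm (\<theta> (Suc k) \<omega>))\<^sup>2)
      \<le> norm (2 * (norm (\<theta> k \<omega>))\<^sup>2 + 2 * (\<alpha> k)\<^sup>2 * (norm (g k \<omega>))\<^sup>2)"
    using norm_add_square_le[of "\<theta> k _" "- (\<alpha> k *\<^sub>R g k _)"]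
    by (intro AE_I2) (simp add: \<theta>_Suc power_mult_distrib mult.assoc)
  then show ?case
    by (rule Bochner_Integration.integrable_bound[rotated 2])
      (use Suc integrable_g_square in auto)
qed

text \<open>A Lipschitz gradient grows at most linearly, so it inherits square integrability from
  the iterate.\<close>

lemma integrable_gradF_square: "integrable M (\<lambda>\<omega>. (norm (gradF (\<theta> k \<omega>)))\<^sup>2)"
proof (rule Bochner_Integration.integrable_bound)
  show "integrable M (\<lambda>\<omega>. 2 * smoothness\<^sup>2 * (norm (\<theta> k \<omega>))\<^sup>2 + 2 * (norm (gradF 0))\<^sup>2)"
    using integrable_\<theta>_square[of k] by simp
  have "(norm (gradF t))\<^sup>2 \<le> 2 * smoothness\<^sup>2 * (norm t)\<^sup>2 + 2 * (norm (gradF 0))\<^sup>2" for t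
  proof -
    have "(norm (gradF t - gradF 0))\<^sup>2 \<le> (smoothness * norm t)\<^sup>2"
      using gradF_lipschitz[of t 0] by (intro power_mono) auto
    with norm_add_square_le[of "gradF t - gradF 0" "gradF 0"] show ?thesis
      by (simp add: power_mult_distrib)
  qed
  then show "AE \<omega> in M. norm ((norm (gradF (\<theta> k \<omega>)))\<^sup>2)
      \<le> norm (2 * smoothness\<^sup>2 * (norm (\<theta> k \<omega>))\<^sup>2 + 2 * (norm (gradF 0))\<^sup>2)"
    by simp
qed measurable

text \<open>Linearization at the origin shows that \<open>F\<close> grows at most
  quadratically.\<close>

lemma integrable_F_\<theta>: "integrable M (\<lambda>\<omega>. F (\<theta> k \<omega>))"
proof (rule Bochner_Integration.integrable_bound)
  show "integrable M (\<lambda>\<omega>. \<bar>F 0\<bar> + (norm (gradF 0))\<^sup>2 + (1 + smoothness) * (norm (\<theta> k \<omega>))\<^sup>2)"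
    using integrable_\<theta>_square[of k] by simp
  have "\<bar>F t\<bar> \<le> \<bar>F 0\<bar> + (norm (gradF 0))\<^sup>2 + (1 + smoothness) * (norm t)\<^sup>2" for t
  proof -
    have "\<bar>F t - F 0 - t \<bullet> gradF 0\<bar> \<le> smoothness * (norm t)\<^sup>2"
      using F_linearization[of t 0] by simp
    moreover have "\<bar>t \<bullet> gradF 0\<bar> \<le> (norm t)\<^sup>2 + (norm (gradF 0))\<^sup>2"
      using Cauchy_Schwarz_ineq2[of t "gradF 0"] sum_squares_bound[of "norm t" "norm (gradF 0)"]
        mult_nonneg_nonneg[OF norm_ge_zero norm_ge_zero, of t "gradF 0"] by linarith
    ultimately show ?thesis
      by (simp add: algebra_simps abs_if split: if_splits)
  qed
  then show "AE \<omega> in M. norm (F (\<theta> k \<omega>))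
      \<le> norm (\<bar>F 0\<bar> + (norm (gradF 0))\<^sup>2 + (1 + smoothness) * (norm (\<theta> k \<omega>))\<^sup>2)"
    using smoothness_nonneg by (intro AE_I2) simp
qed measurable

end

section \<open>Descent of the expected objective\<close>

context dzofl_smooth
begin

text \<open>The directional derivative of \<open>F\<close> at the iterate along the perturbation. As
  \<open>g k\<close> is a multiple of \<open>\<Phi> k\<close>, the inner product of the gradient
  with \<open>g k\<close> is this slope times the server output.\<close>

definition slope :: "nat \<Rightarrow> 'a \<Rightarrow> real" where
  "slope k \<omega> = gradF (\<theta> k \<omega>) \<bullet> \<Phi> k \<omega>"

lemma slope_measurable [measurable]: "slope k \<in> borel_measurable M"
  unfolding slope_def[abs_def] by measurable

lemma slope_source_measurable:
  assumes "past k \<subseteq> A" "Pert k \<in> A"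
  shows "slope k \<in> borel_measurable (source_algebra A)"
proof -
  note [measurable] = \<theta>_sources[OF assms(1)] \<Phi>_source[OF assms(2)]
  show ?thesis unfolding slope_def[abs_def] by measurable
qed

lemma slope_square_le: "AE \<omega> in M. (slope k \<omega>)\<^sup>2 \<le> \<alpha>3\<^sup>2 * (norm (gradF (\<theta> k \<omega>)))\<^sup>2"
  using \<Phi>_bounded[of k]
proof eventually_elim
  case (elim \<omega>)
  have "\<bar>slope k \<omega>\<bar> \<le> norm (gradF (\<theta> k \<omega>)) * norm (\<Phi> k \<omega>)"
    unfolding slope_def by (rule Cauchy_Schwarz_ineq2)
  also have "\<dots> \<le> norm (gradF (\<theta> k \<omega>)) * \<alpha>3"
    using elim by (intro mult_left_mono) auto
  finally have "\<bar>slope k \<omega>\<bar>\<^sup>2 \<le> (norm (gradF (\<theta> k \<omega>)) * \<alpha>3)\<^sup>2"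
    by (intro power_mono) auto
  then show ?case by (simp add: power_mult_distrib mult.commute)
qed

lemma integrable_slope_square: "integrable M (\<lambda>\<omega>. (slope k \<omega>)\<^sup>2)"
  by (rule Bochner_Integration.integrable_bound[of _ "\<lambda>\<omega>. \<alpha>3\<^sup>2 * (norm (gradF (\<theta> k \<omega>)))\<^sup>2"])
    (use slope_square_le integrable_gradF_square in auto)

text \<open>The square is expanded in coordinates. The iterate is independent of the perturbation,
  whose second-moment matrix is \<open>\<alpha>2\<close> times the identity, so only diagonal terms
  survive.\<close>

lemma expectation_slope_square:
  "expectation (\<lambda>\<omega>. (slope k \<omega>)\<^sup>2) = \<alpha>2 * expectation (\<lambda>\<omega>. (norm (gradF (\<theta> k \<omega>)))\<^sup>2)"
proof -
  define v where "v j \<omega> = gradF (\<theta> k \<omega>) $ j" for j \<omega>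
  have [measurable]: "v j \<in> borel_measurable M" for j
    unfolding v_def[abs_def] by (intro borel_measurable_component) measurable
  have v_le: "\<bar>v j \<omega>\<bar> \<le> norm (gradF (\<theta> k \<omega>))" for j \<omega>
    unfolding v_def by (rule component_le_norm_cart)
  have v2: "\<bar>v j \<omega> * v j' \<omega>\<bar> \<le> (norm (gradF (\<theta> k \<omega>)))\<^sup>2" for j j' \<omega>
    unfolding abs_mult power2_eq_square by (intro mult_mono v_le) auto
  have int_v: "integrable M (\<lambda>\<omega>. v j \<omega> * v j' \<omega>)" for j j'
    by (rule Bochner_Integration.integrable_bound[OF integrable_gradF_square[of k]])
      (use v2 in auto)
  have int: "integrable M (\<lambda>\<omega>. (v j \<omega> * v j' \<omega>) * (\<Phi> k \<omega> $ j * \<Phi> k \<omega> $ j'))" for j j'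
  proof (rule Bochner_Integration.integrable_bound)
    show "integrable M (\<lambda>\<omega>. (norm (gradF (\<theta> k \<omega>)))\<^sup>2 * \<alpha>3\<^sup>2)"
      using integrable_gradF_square[of k] by simp
    show "AE \<omega> in M. norm ((v j \<omega> * v j' \<omega>) * (\<Phi> k \<omega> $ j * \<Phi> k \<omega> $ j'))
        \<le> norm ((norm (gradF (\<theta> k \<omega>)))\<^sup>2 * \<alpha>3\<^sup>2)"
      using \<Phi>_bounded[of k]
    proof eventually_elim
      case (elim \<omega>)
      have "\<bar>\<Phi> k \<omega> $ i\<bar> \<le> \<alpha>3" for i
        using component_le_norm_cart[of "\<Phi> k \<omega>" i] elim by linarith
      then have "\<bar>\<Phi> k \<omega> $ j * \<Phi> k \<omega> $ j'\<bar> \<le> \<alpha>3\<^sup>2"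
        unfolding abs_mult power2_eq_square using \<alpha>3_pos by (intro mult_mono) auto
      then have "\<bar>v j \<omega> * v j' \<omega>\<bar> * \<bar>\<Phi> k \<omega> $ j * \<Phi> k \<omega> $ j'\<bar> \<le> (norm (gradF (\<theta> k \<omega>)))\<^sup>2 * \<alpha>3\<^sup>2"
        by (intro mult_mono v2) auto
      then show ?case by (simp add: abs_mult)
    qed
  qed (intro borel_measurable_times borel_measurable_component; measurable)
  have indep: "expectation (\<lambda>\<omega>. (v j \<omega> * v j' \<omega>) * (\<Phi> k \<omega> $ j * \<Phi> k \<omega> $ j'))
      = (if j' = j then \<alpha>2 * expectation (\<lambda>\<omega>. v j \<omega> * v j \<omega>) else 0)" for j j'
  proof -
    note [measurable] = \<theta>_source_measurable[of k] \<Phi>_source[of k "{Pert k}", simplified]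
    have "(\<lambda>\<omega>. v j \<omega> * v j' \<omega>) \<in> borel_measurable (source_algebra (past k))"
      unfolding v_def by (intro borel_measurable_times borel_measurable_component) measurable
    moreover have "(\<lambda>\<omega>. \<Phi> k \<omega> $ j * \<Phi> k \<omega> $ j') \<in> borel_measurable (source_algebra {Pert k})"
      by (intro borel_measurable_times borel_measurable_component) measurable
    ultimately have "expectation (\<lambda>\<omega>. (v j \<omega> * v j' \<omega>) * (\<Phi> k \<omega> $ j * \<Phi> k \<omega> $ j'))
        = expectation (\<lambda>\<omega>. v j \<omega> * v j' \<omega>) * expectation (\<lambda>\<omega>. \<Phi> k \<omega> $ j * \<Phi> k \<omega> $ j')"
      using past_subset fresh_sources[where k = k]
      by (intro expectation_mult_joint joint_distr_of_disjoint_sources int)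
        (auto intro!: borel_measurable_times borel_measurable_component \<Phi>_measurable)
    then show ?thesis
      using \<Phi>_uncorrelated[of j j' k] \<Phi>_second_moment[of k j]
      by (auto simp: power2_eq_square)
  qed
  have "(slope k \<omega>)\<^sup>2
      = (\<Sum>j\<in>UNIV. \<Sum>j'\<in>UNIV. (v j \<omega> * v j' \<omega>) * (\<Phi> k \<omega> $ j * \<Phi> k \<omega> $ j'))" for \<omega>
    by (simp add: slope_def inner_vec_def v_def power2_eq_square sum_product mult_ac)
  then have "expectation (\<lambda>\<omega>. (slope k \<omega>)\<^sup>2) = (\<Sum>j\<in>UNIV. \<Sum>j'\<in>UNIV.
      expectation (\<lambda>\<omega>. (v j \<omega> * v j' \<omega>) * (\<Phi> k \<omega> $ j * \<Phi> k \<omega> $ j')))"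
    using int by (simp add: Bochner_Integration.integral_sum Bochner_Integration.integrable_sum)
  also have "\<dots> = (\<Sum>j\<in>UNIV. \<alpha>2 * expectation (\<lambda>\<omega>. v j \<omega> * v j \<omega>))"
    unfolding indep by simp
  also have "\<dots> = \<alpha>2 * expectation (\<lambda>\<omega>. \<Sum>j\<in>UNIV. v j \<omega> * v j \<omega>)"
    using int_v by (simp add: Bochner_Integration.integral_sum sum_distrib_left)
  also have "(\<lambda>\<omega>. \<Sum>j\<in>UNIV. v j \<omega> * v j \<omega>) = (\<lambda>\<omega>. (norm (gradF (\<theta> k \<omega>)))\<^sup>2)"
    by (simp add: v_def power2_norm_eq_inner inner_vec_def)
  finally show ?thesis .
qed

text \<open>Integrating out the sample of device \<open>i\<close>, with iterate and perturbation
  frozen, replaces \<open>f i\<close> by its mean \<open>F_local i\<close>.\<close>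

lemma expectation_slope_\<delta>:
  fixes k
  assumes i: "i \<in> {1..N}"
  defines "d \<equiv> \<lambda>\<omega>. slope k \<omega> * (F_local i (\<theta> k \<omega> + \<gamma> k *\<^sub>R \<Phi> k \<omega>) - F_local i (\<theta> k \<omega> - \<gamma> k *\<^sub>R \<Phi> k \<omega>))"
  shows "integrable M d" "expectation (\<lambda>\<omega>. slope k \<omega> * \<delta> i k \<omega>) = expectation d"
proof -
  let ?A = "past k \<union> {Pert k}"
  \<comment> \<open>The slope and both query points form one tuple, a function of the past and the
    perturbation and hence independent of the sample.\<close>
  let ?X = "\<lambda>\<omega>. (slope k \<omega>, \<theta> k \<omega> + \<gamma> k *\<^sub>R \<Phi> k \<omega>, \<theta> k \<omega> - \<gamma> k *\<^sub>R \<Phi> k \<omega>)"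
  let ?h = "\<lambda>((a, s, t), x). a * (f i s x - f i t x)"
  have [measurable]: "\<theta> k \<in> borel_measurable (source_algebra ?A)"
    "\<Phi> k \<in> borel_measurable (source_algebra ?A)" "slope k \<in> borel_measurable (source_algebra ?A)"
    by (auto intro: \<theta>_sources \<Phi>_source slope_source_measurable)
  have X: "?X \<in> measurable (source_algebra ?A) (borel \<Otimes>\<^sub>M borel \<Otimes>\<^sub>M borel)"
    by measurable
  have Y: "\<xi> i k \<in> measurable (source_algebra {Data k}) (D i)"
    using i by (intro \<xi>_source) auto
  have sources: "?A \<subseteq> sources" "{Data k} \<subseteq> sources" "?A \<inter> {Data k} = {}"
    using past_subset fresh_sources[where k = k] by auto
  have h: "?h \<in> borel_measurable ((borel \<Otimes>\<^sub>M borel \<Otimes>\<^sub>M borel) \<Otimes>\<^sub>M D i)"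
    unfolding case_prod_beta
    by (intro borel_measurable_times borel_measurable_diff measurable_f_comp[OF i]) measurable
  have "integrable M (\<lambda>\<omega>. slope k \<omega> * \<delta> i k \<omega>)"
    using i by (intro integrable_mult_of_squares slope_measurable \<delta>_measurable
        integrable_slope_square integrable_\<delta>_square)
  moreover have eq: "slope k \<omega> * \<delta> i k \<omega> = ?h (?X \<omega>, \<xi> i k \<omega>)" if "\<omega> \<in> space M" for \<omega>
    using that i by (simp add: \<delta>_eq)
  ultimately have int: "integrable M (\<lambda>\<omega>. ?h (?X \<omega>, \<xi> i k \<omega>))"
    by (simp cong: Bochner_Integration.integrable_cong)
  have inner: "(\<integral>x. ?h (?X \<omega>, x) \<partial>distr M (D i) (\<xi> i k)) = d \<omega>" for \<omega>
    using f_integrable[OF i] by (simp add: \<xi>_distr[OF i] d_def local_objective_def)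
  note J = integral_joint[OF random_variable_source_algebra[OF X sources(1)] \<xi>_measurable[OF i]
      joint_distr_of_disjoint_sources[OF X Y sources] h int, unfolded inner]
  show "integrable M d" using J(1) .
  have "expectation (\<lambda>\<omega>. slope k \<omega> * \<delta> i k \<omega>) = expectation (\<lambda>\<omega>. ?h (?X \<omega>, \<xi> i k \<omega>))"
    using eq by (intro Bochner_Integration.integral_cong) auto
  with J(2) show "expectation (\<lambda>\<omega>. slope k \<omega> * \<delta> i k \<omega>) = expectation d" by simp
qed

text \<open>Two sources are removed in turn: the device quantizer by unbiasedness, then the
  reception weight, which factors out because it is independent of iterate, perturbation and
  data.\<close>

lemma expectation_weighted_Q_V:
  assumes i: "i \<in> {1..N}"
  shows "integrable M (\<lambda>\<omega>. slope k \<omega> * weight i (S k \<omega>) * Q (\<delta> i k \<omega>) (V i k \<omega>))"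
    and "expectation (\<lambda>\<omega>. slope k \<omega> * weight i (S k \<omega>) * Q (\<delta> i k \<omega>) (V i k \<omega>))
      = mean_weight k * expectation (\<lambda>\<omega>. slope k \<omega> * \<delta> i k \<omega>)"
proof -
  have sq: "integrable M (\<lambda>\<omega>. (slope k \<omega> * weight i (S k \<omega>))\<^sup>2)"
  proof (rule Bochner_Integration.integrable_bound)
    show "integrable M (\<lambda>\<omega>. (slope k \<omega>)\<^sup>2 * (real N)\<^sup>2)"
      using integrable_slope_square by simp
    show "AE \<omega> in M. norm ((slope k \<omega> * weight i (S k \<omega>))\<^sup>2) \<le> norm ((slope k \<omega>)\<^sup>2 * (real N)\<^sup>2)"
      using weight_bounds[OF S_subset]
      by (intro AE_I2) (auto simp: power_mult_distrib intro!: mult_left_mono power_mono)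
  qed measurable
  show int: "integrable M (\<lambda>\<omega>. slope k \<omega> * weight i (S k \<omega>) * Q (\<delta> i k \<omega>) (V i k \<omega>))"
    using i sq by (intro integrable_mult_of_squares Q_V_measurable integrable_Q_V_square) measurable
  let ?A = "past k \<union> {Pert k, Data k}"
  \<comment> \<open>While the device seed is integrated out, the weight has to be frozen too, so the
    reception set joins the sources independent of the seed.\<close>
  let ?B = "insert (Recv k) ?A"
  have \<delta>A: "\<delta> i k \<in> borel_measurable (source_algebra ?A)"
    using i by (intro \<delta>_source_measurable \<theta>_sources) auto
  have slopeA: "slope k \<in> borel_measurable (source_algebra ?A)"
    by (intro slope_source_measurable) auto
  have weightR: "(\<lambda>\<omega>. weight i (S k \<omega>)) \<in> borel_measurable (source_algebra {Recv k})"
    by (intro measurable_compose[OF S_source]) auto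
  have sources: "?A \<subseteq> sources" "?B \<subseteq> sources" "{Recv k} \<subseteq> sources" "{DevNoise i k} \<subseteq> sources"
    "?A \<inter> {Recv k} = {}" "?B \<inter> {DevNoise i k} = {}"
    using past_subset fresh_sources(1-3)[where k = k] fresh_sources(4)[OF i, of k] by auto
  have SB: "(\<lambda>\<omega>. slope k \<omega> * weight i (S k \<omega>)) \<in> borel_measurable (source_algebra ?B)"
    by (intro borel_measurable_times measurable_source_algebra_mono[OF slopeA]
        measurable_source_algebra_mono[OF weightR]) auto
  have \<delta>B: "\<delta> i k \<in> borel_measurable (source_algebra ?B)"
    by (rule measurable_source_algebra_mono[OF \<delta>A]) auto
  have VD: "V i k \<in> measurable (source_algebra {DevNoise i k}) U"
    using i by (intro V_source) auto
  note E = expectation_Q[OF SB \<delta>B VD sources(2,4,6) V_distr[OF i] int]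
  have "expectation (\<lambda>\<omega>. slope k \<omega> * weight i (S k \<omega>) * Q (\<delta> i k \<omega>) (V i k \<omega>))
      = expectation (\<lambda>\<omega>. (slope k \<omega> * \<delta> i k \<omega>) * weight i (S k \<omega>))"
    unfolding E(2) by (simp add: mult_ac)
  also have "\<dots> = expectation (\<lambda>\<omega>. slope k \<omega> * \<delta> i k \<omega>) * expectation (\<lambda>\<omega>. weight i (S k \<omega>))"
  proof (rule expectation_mult_joint)
    show "(\<lambda>\<omega>. slope k \<omega> * \<delta> i k \<omega>) \<in> borel_measurable M"
      using \<delta>_measurable[OF i] by measurable
    show "distr M (borel \<Otimes>\<^sub>M borel) (\<lambda>\<omega>. (slope k \<omega> * \<delta> i k \<omega>, weight i (S k \<omega>)))
        = distr M borel (\<lambda>\<omega>. slope k \<omega> * \<delta> i k \<omega>) \<Otimes>\<^sub>M distr M borel (\<lambda>\<omega>. weight i (S k \<omega>))"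
      by (rule joint_distr_of_disjoint_sources[OF borel_measurable_times[OF slopeA \<delta>A] weightR
            sources(1,3,5)])
    show "integrable M (\<lambda>\<omega>. slope k \<omega> * \<delta> i k \<omega> * weight i (S k \<omega>))"
      using E(1) by (simp add: mult_ac)
  qed (rule weight_S_measurable)
  finally show "expectation (\<lambda>\<omega>. slope k \<omega> * weight i (S k \<omega>) * Q (\<delta> i k \<omega>) (V i k \<omega>))
      = mean_weight k * expectation (\<lambda>\<omega>. slope k \<omega> * \<delta> i k \<omega>)"
    by (simp add: expectation_weight[OF i])
qed

text \<open>The server quantizer is removed first, by unbiasedness. What is left is a sum over the
  devices, and since \<open>mean_weight k\<close> is common to all of them the local differences
  recombine to the difference of \<open>F\<close>.\<close>

lemma expectation_gradF_g:
  defines "d \<equiv> \<lambda>k \<omega>. slope k \<omega> * (F (\<theta> k \<omega> + \<gamma> k *\<^sub>R \<Phi> k \<omega>) - F (\<theta> k \<omega> - \<gamma> k *\<^sub>R \<Phi> k \<omega>))"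
  shows "integrable M (\<lambda>\<omega>. gradF (\<theta> k \<omega>) \<bullet> g k \<omega>)" "integrable M (d k)"
    and "expectation (\<lambda>\<omega>. gradF (\<theta> k \<omega>) \<bullet> g k \<omega>) = mean_weight k * expectation (d k)"
proof -
  let ?A = "past k \<union> ({Pert k, Data k, Recv k} \<union> (\<lambda>i. DevNoise i k) ` {1..N})"
  have int: "integrable M (\<lambda>\<omega>. slope k \<omega> * Q (\<Delta> k \<omega>) (W k \<omega>))"
    by (intro integrable_mult_of_squares integrable_slope_square integrable_Q_W_square) measurable
  have eq: "gradF (\<theta> k \<omega>) \<bullet> g k \<omega> = slope k \<omega> * Q (\<Delta> k \<omega>) (W k \<omega>)" if "\<omega> \<in> space M" for \<omega>
    using that by (simp add: g_eq slope_def mult.commute)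
  show "integrable M (\<lambda>\<omega>. gradF (\<theta> k \<omega>) \<bullet> g k \<omega>)"
    using int eq by (simp cong: Bochner_Integration.integrable_cong)
  have d: "d k = (\<lambda>\<omega>. \<Sum>i\<in>{1..N}. slope k \<omega> *
      (F_local i (\<theta> k \<omega> + \<gamma> k *\<^sub>R \<Phi> k \<omega>) - F_local i (\<theta> k \<omega> - \<gamma> k *\<^sub>R \<Phi> k \<omega>)))"
    by (simp add: d_def global_objective_def sum_distrib_left[symmetric] sum_subtractf)
  show "integrable M (d k)"
    unfolding d by (intro Bochner_Integration.integrable_sum expectation_slope_\<delta>)
  have "expectation (\<lambda>\<omega>. gradF (\<theta> k \<omega>) \<bullet> g k \<omega>) = expectation (\<lambda>\<omega>. slope k \<omega> * Q (\<Delta> k \<omega>) (W k \<omega>))"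
    using eq by (intro Bochner_Integration.integral_cong) auto
  also have "\<dots> = expectation (\<lambda>\<omega>. slope k \<omega> * \<Delta> k \<omega>)"
  proof (rule expectation_Q(2)[OF _ _ _ _ _ _ W_distr int])
    show "slope k \<in> borel_measurable (source_algebra ?A)"
      by (intro slope_source_measurable) auto
    show "\<Delta> k \<in> borel_measurable (source_algebra ?A)"
      by (intro \<Delta>_source_measurable \<theta>_sources) auto
    show "W k \<in> measurable (source_algebra {SrvNoise k}) U"
      by (intro W_source) auto
  qed (use past_subset fresh_sources[where k = k] in auto)
  also have "\<dots> = expectation (\<lambda>\<omega>. \<Sum>i\<in>{1..N}.
      slope k \<omega> * weight i (S k \<omega>) * Q (\<delta> i k \<omega>) (V i k \<omega>))"
    by (intro Bochner_Integration.integral_cong)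
      (simp_all add: \<Delta>_eq_weighted_sum sum_distrib_left mult.assoc)
  also have "\<dots> = (\<Sum>i\<in>{1..N}. mean_weight k * expectation (\<lambda>\<omega>. slope k \<omega> * \<delta> i k \<omega>))"
    using expectation_weighted_Q_V by (simp add: Bochner_Integration.integral_sum)
  also have "\<dots> = mean_weight k * expectation (d k)"
    using expectation_slope_\<delta>
    by (simp add: d Bochner_Integration.integral_sum sum_distrib_left)
  finally show "expectation (\<lambda>\<omega>. gradF (\<theta> k \<omega>) \<bullet> g k \<omega>) = mean_weight k * expectation (d k)" .
qed

text \<open>The symmetric difference of \<open>F\<close> is
  \<open>2 * \<gamma> k * slope k \<omega>\<close> up to an error \<open>r\<close> of order
  \<open>(\<gamma> k)\<^sup>2\<close>. Half of the leading term absorbs the product of slope and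
  error and leaves a cubic remainder.\<close>

lemma expectation_gradF_g_ge:
  "expectation (\<lambda>\<omega>. gradF (\<theta> k \<omega>) \<bullet> g k \<omega>)
    \<ge> p * \<alpha>2 * \<gamma> k * expectation (\<lambda>\<omega>. (norm (gradF (\<theta> k \<omega>)))\<^sup>2)
      - real N * smoothness\<^sup>2 * \<alpha>3 ^ 4 * \<gamma> k ^ 3"
proof -
  let ?d = "\<lambda>\<omega>. slope k \<omega> * (F (\<theta> k \<omega> + \<gamma> k *\<^sub>R \<Phi> k \<omega>) - F (\<theta> k \<omega> - \<gamma> k *\<^sub>R \<Phi> k \<omega>))"
  let ?a = "expectation (\<lambda>\<omega>. (norm (gradF (\<theta> k \<omega>)))\<^sup>2)"
  let ?b = "smoothness\<^sup>2 * \<alpha>3 ^ 4 * \<gamma> k ^ 3"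
  have pos: "0 < \<gamma> k" by (rule steps_pos)
  have "AE \<omega> in M. \<gamma> k * (slope k \<omega>)\<^sup>2 - ?b \<le> ?d \<omega>"
    using \<Phi>_bounded[of k]
  proof eventually_elim
    case (elim \<omega>)
    define h where "h = \<gamma> k *\<^sub>R \<Phi> k \<omega>"
    define r where "r = F (\<theta> k \<omega> + h) - F (\<theta> k \<omega> - h) - 2 * \<gamma> k * slope k \<omega>"
    have lin: "\<bar>F (\<theta> k \<omega> + h) - F (\<theta> k \<omega>) - h \<bullet> gradF (\<theta> k \<omega>)\<bar> \<le> smoothness * (norm h)\<^sup>2"
      "\<bar>F (\<theta> k \<omega> - h) - F (\<theta> k \<omega>) + h \<bullet> gradF (\<theta> k \<omega>)\<bar> \<le> smoothness * (norm h)\<^sup>2"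
      using F_linearization[of "\<theta> k \<omega> + h" "\<theta> k \<omega>"] F_linearization[of "\<theta> k \<omega> - h" "\<theta> k \<omega>"]
      by simp_all
    have "h \<bullet> gradF (\<theta> k \<omega>) = \<gamma> k * slope k \<omega>"
      by (simp add: h_def slope_def inner_commute)
    with lin have "\<bar>r\<bar> \<le> 2 * (smoothness * (norm h)\<^sup>2)"
      unfolding r_def abs_le_iff by linarith
    also have "\<dots> \<le> 2 * (smoothness * (\<gamma> k * \<alpha>3)\<^sup>2)"
      using elim pos smoothness_nonneg
      by (intro mult_left_mono power_mono) (auto simp: h_def)
    finally have r: "\<bar>r\<bar> \<le> 2 * smoothness * (\<gamma> k)\<^sup>2 * \<alpha>3\<^sup>2"
      by (simp add: power_mult_distrib)
    \<comment> \<open>Completing the square: the slope times the bound on \<open>r\<close> is at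
      most \<open>\<gamma> k * (slope k \<omega>)\<^sup>2\<close> plus the cubic remainder
      \<open>?b\<close>.\<close>
    have "0 \<le> \<gamma> k * (\<bar>slope k \<omega>\<bar> - smoothness * \<gamma> k * \<alpha>3\<^sup>2)\<^sup>2"
      using pos by simp
    also have "\<dots> = \<gamma> k * (slope k \<omega>)\<^sup>2 + ?b - \<bar>slope k \<omega>\<bar> * (2 * smoothness * (\<gamma> k)\<^sup>2 * \<alpha>3\<^sup>2)"
      by (simp add: power2_diff algebra_simps power2_eq_square power3_eq_cube power4_eq_xxxx)
    also have "\<dots> \<le> \<gamma> k * (slope k \<omega>)\<^sup>2 + ?b - \<bar>slope k \<omega>\<bar> * \<bar>r\<bar>"
      using mult_left_mono[OF r, of "\<bar>slope k \<omega>\<bar>"] by simp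
    also have "\<dots> \<le> \<gamma> k * (slope k \<omega>)\<^sup>2 + ?b + slope k \<omega> * r"
      using abs_ge_minus_self[of "slope k \<omega> * r"] by (simp add: abs_mult)
    finally show ?case
      unfolding h_def[symmetric] by (simp add: r_def algebra_simps power2_eq_square)
  qed
  then have "expectation (\<lambda>\<omega>. \<gamma> k * (slope k \<omega>)\<^sup>2 - ?b) \<le> expectation ?d"
    using integrable_slope_square expectation_gradF_g(2) by (intro integral_mono_AE) auto
  moreover have "expectation (\<lambda>\<omega>. \<gamma> k * (slope k \<omega>)\<^sup>2 - ?b) = \<gamma> k * (\<alpha>2 * ?a) - ?b"
    using integrable_slope_square[of k] by (simp add: expectation_slope_square prob_space)
  ultimately have "mean_weight k * (\<gamma> k * (\<alpha>2 * ?a) - ?b) \<le> expectation (\<lambda>\<omega>. gradF (\<theta> k \<omega>) \<bullet> g k \<omega>)"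
    unfolding expectation_gradF_g(3) using mean_weight_bounds(1)[of k] p_bounds
    by (intro mult_left_mono) auto
  \<comment> \<open>\<open>mean_weight k\<close> is estimated from below by \<open>p\<close> on the
    nonnegative gradient term and from above by \<open>N\<close> on the remainder.\<close>
  moreover have "p * (\<gamma> k * (\<alpha>2 * ?a)) \<le> mean_weight k * (\<gamma> k * (\<alpha>2 * ?a))"
    using mean_weight_bounds(1)[of k] pos \<alpha>2_pos by (intro mult_right_mono) auto
  moreover have "mean_weight k * ?b \<le> real N * ?b"
    using mean_weight_bounds(2)[of k] pos by (intro mult_right_mono) auto
  ultimately show ?thesis
    by (simp add: right_diff_distrib mult_ac)
qed

text \<open>The smoothness inequality between consecutive iterates, in expectation: the linear term
  is the drift just bounded from below, and the quadratic term is controlled by the second moment of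
  \<open>g k\<close>.\<close>

lemma expected_descent:
  "expectation (\<lambda>\<omega>. F (\<theta> (Suc k) \<omega>))
    \<le> expectation (\<lambda>\<omega>. F (\<theta> k \<omega>))
      - p * \<alpha>2 * (\<alpha> k * \<gamma> k * expectation (\<lambda>\<omega>. (norm (gradF (\<theta> k \<omega>)))\<^sup>2))
      + real N * smoothness\<^sup>2 * \<alpha>3 ^ 4 * (\<alpha> k * \<gamma> k ^ 3)
      + smoothness * g_moment * ((\<alpha> k)\<^sup>2 * (\<gamma> k)\<^sup>2)"
proof -
  let ?G = "\<lambda>\<omega>. gradF (\<theta> k \<omega>) \<bullet> g k \<omega>"
  have int: "integrable M (\<lambda>\<omega>. F (\<theta> k \<omega>) - \<alpha> k * ?G \<omega>)"
    "integrable M (\<lambda>\<omega>. smoothness * (\<alpha> k)\<^sup>2 * (norm (g k \<omega>))\<^sup>2)"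
    using integrable_F_\<theta>[of k] expectation_gradF_g(1)[of k] integrable_g_square[of k] by auto
  have "expectation (\<lambda>\<omega>. F (\<theta> (Suc k) \<omega>))
      \<le> expectation (\<lambda>\<omega>. F (\<theta> k \<omega>) - \<alpha> k * ?G \<omega> + smoothness * (\<alpha> k)\<^sup>2 * (norm (g k \<omega>))\<^sup>2)"
  proof (rule integral_mono)
    fix \<omega> assume \<omega>: "\<omega> \<in> space M"
    have "\<bar>F (\<theta> (Suc k) \<omega>) - F (\<theta> k \<omega>) - (- (\<alpha> k *\<^sub>R g k \<omega>)) \<bullet> gradF (\<theta> k \<omega>)\<bar>
        \<le> smoothness * (norm (\<alpha> k *\<^sub>R g k \<omega>))\<^sup>2"
      using F_linearization[of "\<theta> (Suc k) \<omega>" "\<theta> k \<omega>"] by (simp add: \<theta>_Suc[OF \<omega>])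
    then show "F (\<theta> (Suc k) \<omega>) \<le> F (\<theta> k \<omega>) - \<alpha> k * ?G \<omega> + smoothness * (\<alpha> k)\<^sup>2 * (norm (g k \<omega>))\<^sup>2"
      by (simp add: power_mult_distrib inner_commute abs_le_iff mult.assoc)
  qed (use int integrable_F_\<theta> in auto)
  also have "\<dots> = expectation (\<lambda>\<omega>. F (\<theta> k \<omega>)) - \<alpha> k * expectation ?G
      + smoothness * (\<alpha> k)\<^sup>2 * expectation (\<lambda>\<omega>. (norm (g k \<omega>))\<^sup>2)"
    using int integrable_F_\<theta>[of k] expectation_gradF_g(1)[of k] integrable_g_square[of k] by simp
  also have "\<dots> \<le> expectation (\<lambda>\<omega>. F (\<theta> k \<omega>))
      - \<alpha> k * (p * \<alpha>2 * \<gamma> k * expectation (\<lambda>\<omega>. (norm (gradF (\<theta> k \<omega>)))\<^sup>2)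
          - real N * smoothness\<^sup>2 * \<alpha>3 ^ 4 * \<gamma> k ^ 3)
      + smoothness * (\<alpha> k)\<^sup>2 * (g_moment * (\<gamma> k)\<^sup>2)"
    using steps_pos(1)[of k] smoothness_nonneg
    by (intro add_mono diff_mono mult_left_mono expectation_gradF_g_ge g_second_moment(2)) auto
  finally show ?thesis
    by (simp add: algebra_simps)
qed

text \<open>One step moves the gradient by at most
  \<open>smoothness * \<alpha> k * norm (g k \<omega>)\<close>, whose L2 norm is of order
  \<open>\<alpha> k * \<gamma> k\<close>. Minkowski's inequality in both directions bounds the
  change of the L2 norm.\<close>

lemma gradF_slow_variation:
  "\<bar>sqrt (expectation (\<lambda>\<omega>. (norm (gradF (\<theta> (Suc k) \<omega>)))\<^sup>2))
      - sqrt (expectation (\<lambda>\<omega>. (norm (gradF (\<theta> k \<omega>)))\<^sup>2))\<bar>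
    \<le> (smoothness * sqrt g_moment + 1) * (\<alpha> k * \<gamma> k)"
proof -
  let ?Z = "\<lambda>\<omega>. smoothness * \<alpha> k * norm (g k \<omega>)"
  \<comment> \<open>The summand 1 keeps \<open>?c\<close> positive, as \<open>minkowski_L2\<close>
    demands, even if \<open>g_moment\<close> is 0.\<close>
  let ?c = "(smoothness * sqrt g_moment + 1) * (\<alpha> k * \<gamma> k)"
  have pos: "0 < \<alpha> k" "0 < \<gamma> k" by (rule steps_pos)+
  have Z: "integrable M (\<lambda>\<omega>. (?Z \<omega>)\<^sup>2)"
    using integrable_g_square[of k] by (simp add: power_mult_distrib)
  have "expectation (\<lambda>\<omega>. (?Z \<omega>)\<^sup>2) = smoothness\<^sup>2 * (\<alpha> k)\<^sup>2 * expectation (\<lambda>\<omega>. (norm (g k \<omega>))\<^sup>2)"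
    by (simp add: power_mult_distrib)
  also have "\<dots> \<le> smoothness\<^sup>2 * (\<alpha> k)\<^sup>2 * (g_moment * (\<gamma> k)\<^sup>2)"
    by (intro mult_left_mono g_second_moment(2)) simp
  also have "\<dots> = (smoothness * sqrt g_moment * (\<alpha> k * \<gamma> k))\<^sup>2"
    using g_moment_nonneg by (simp add: power_mult_distrib)
  also have "\<dots> \<le> ?c\<^sup>2"
    using pos smoothness_nonneg g_moment_nonneg by (intro power_mono mult_right_mono) auto
  finally have c: "expectation (\<lambda>\<omega>. (?Z \<omega>)\<^sup>2) \<le> ?c\<^sup>2" .
  have "0 < ?c"
    using pos smoothness_nonneg g_moment_nonneg by (intro mult_pos_pos add_nonneg_pos) auto
  have diff: "norm (gradF (\<theta> (Suc k) \<omega>) - gradF (\<theta> k \<omega>)) \<le> \<bar>?Z \<omega>\<bar>" if "\<omega> \<in> space M" for \<omega>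
    using gradF_lipschitz[of "\<theta> (Suc k) \<omega>" "\<theta> k \<omega>"] pos smoothness_nonneg
    by (simp add: \<theta>_Suc[OF that] abs_mult)
  have "AE \<omega> in M. \<bar>norm (gradF (\<theta> (Suc k) \<omega>))\<bar> \<le> \<bar>norm (gradF (\<theta> k \<omega>))\<bar> + \<bar>?Z \<omega>\<bar>"
  proof (rule AE_I2)
    fix \<omega> assume "\<omega> \<in> space M"
    from diff[OF this] norm_triangle_ineq2[of "gradF (\<theta> (Suc k) \<omega>)" "gradF (\<theta> k \<omega>)"]
    show "\<bar>norm (gradF (\<theta> (Suc k) \<omega>))\<bar> \<le> \<bar>norm (gradF (\<theta> k \<omega>))\<bar> + \<bar>?Z \<omega>\<bar>"
      unfolding abs_norm_cancel by linarith
  qed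
  note up = minkowski_L2[OF integrable_gradF_square integrable_gradF_square Z this c \<open>0 < ?c\<close>]
  have "AE \<omega> in M. \<bar>norm (gradF (\<theta> k \<omega>))\<bar> \<le> \<bar>norm (gradF (\<theta> (Suc k) \<omega>))\<bar> + \<bar>?Z \<omega>\<bar>"
  proof (rule AE_I2)
    fix \<omega> assume "\<omega> \<in> space M"
    from diff[OF this] norm_triangle_ineq3[of "gradF (\<theta> (Suc k) \<omega>)" "gradF (\<theta> k \<omega>)"]
    show "\<bar>norm (gradF (\<theta> k \<omega>))\<bar> \<le> \<bar>norm (gradF (\<theta> (Suc k) \<omega>))\<bar> + \<bar>?Z \<omega>\<bar>"
      unfolding abs_norm_cancel by linarith
  qed
  note down = minkowski_L2[OF integrable_gradF_square integrable_gradF_square Z this c \<open>0 < ?c\<close>]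
  from up down show ?thesis by linarith
qed

section \<open>Summability and convergence of the gradient moments\<close>

lemma summable_gradF_moments:
  assumes min: "\<And>t. F \<theta>min \<le> F t"
    and sums: "summable (\<lambda>k. \<alpha> k * \<gamma> k ^ 3)" "summable (\<lambda>k. (\<alpha> k)\<^sup>2 * (\<gamma> k)\<^sup>2)"
  shows "summable (\<lambda>k. \<alpha> k * \<gamma> k * expectation (\<lambda>\<omega>. (norm (gradF (\<theta> k \<omega>)))\<^sup>2))"
proof -
  define a where "a k = \<alpha> k * \<gamma> k * expectation (\<lambda>\<omega>. (norm (gradF (\<theta> k \<omega>)))\<^sup>2)" for k
  define e where "e k = real N * smoothness\<^sup>2 * \<alpha>3 ^ 4 * (\<alpha> k * \<gamma> k ^ 3)
      + smoothness * g_moment * ((\<alpha> k)\<^sup>2 * (\<gamma> k)\<^sup>2)" for k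
  have e: "summable e"
    unfolding e_def using sums by (intro summable_add summable_mult)
  have e_nonneg: "0 \<le> e k" for k
    using steps_pos[of k] smoothness_nonneg g_moment_nonneg by (simp add: e_def)
  have pa: "0 < p * \<alpha>2"
    using p_bounds \<alpha>2_pos by simp
  have step: "p * \<alpha>2 * a k \<le> expectation (\<lambda>\<omega>. F (\<theta> k \<omega>)) - expectation (\<lambda>\<omega>. F (\<theta> (Suc k) \<omega>)) + e k" for k
    using expected_descent[of k] by (simp add: a_def e_def)
  have "(\<Sum>k<n. p * \<alpha>2 * a k) \<le> expectation (\<lambda>\<omega>. F (\<theta> 0 \<omega>)) - F \<theta>min + suminf e" for n
  proof -
    have "F \<theta>min = expectation (\<lambda>\<omega>. F \<theta>min)"
      by (simp add: prob_space)
    also have "\<dots> \<le> expectation (\<lambda>\<omega>. F (\<theta> n \<omega>))"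
      using integrable_F_\<theta> min by (intro integral_mono) auto
    finally have low: "F \<theta>min \<le> expectation (\<lambda>\<omega>. F (\<theta> n \<omega>))" .
    \<comment> \<open>Telescoping leaves the first and the last expected objective, and the last is
      at least the minimum. The errors are bounded by their full series, so the bound is uniform in
      \<open>n\<close>.\<close>
    have "(\<Sum>k<n. p * \<alpha>2 * a k)
        \<le> (\<Sum>k<n. expectation (\<lambda>\<omega>. F (\<theta> k \<omega>)) - expectation (\<lambda>\<omega>. F (\<theta> (Suc k) \<omega>)) + e k)"
      by (intro sum_mono step)
    also have "\<dots> = expectation (\<lambda>\<omega>. F (\<theta> 0 \<omega>)) - expectation (\<lambda>\<omega>. F (\<theta> n \<omega>)) + sum e {..<n}"
      by (simp add: sum.distrib sum_lessThan_telescope'[of "\<lambda>k. expectation (\<lambda>\<omega>. F (\<theta> k \<omega>))"])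
    also have "\<dots> \<le> expectation (\<lambda>\<omega>. F (\<theta> 0 \<omega>)) - F \<theta>min + suminf e"
      using low sum_le_suminf[OF e, of "{..<n}"] e_nonneg by simp
    finally show ?thesis .
  qed
  then have "summable (\<lambda>k. p * \<alpha>2 * a k)"
    using pa steps_pos[THEN less_imp_le]
    by (intro summableI_nonneg_bounded) (auto simp: a_def intro!: mult_nonneg_nonneg)
  then have "summable a"
    using pa by (auto simp: summable_cmult_iff)
  then show ?thesis
    unfolding a_def[abs_def] .
qed

text \<open>The deterministic criterion is applied with \<open>w k = \<alpha> k * \<gamma> k\<close>
  to the root mean squares, because these, rather than the moments themselves, are known to change
  by a multiple of \<open>w k\<close> per step.\<close>

lemma gradF_moments_tendsto_zero:
  assumes min: "\<And>t. F \<theta>min \<le> F t"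
    and div: "\<not> summable (\<lambda>k. \<alpha> k * \<gamma> k)"
    and sums: "summable (\<lambda>k. \<alpha> k * \<gamma> k ^ 3)" "summable (\<lambda>k. (\<alpha> k)\<^sup>2 * (\<gamma> k)\<^sup>2)"
  shows "(\<lambda>k. expectation (\<lambda>\<omega>. (norm (gradF (\<theta> k \<omega>)))\<^sup>2)) \<longlonglongrightarrow> 0"
proof -
  let ?s = "\<lambda>k. sqrt (expectation (\<lambda>\<omega>. (norm (gradF (\<theta> k \<omega>)))\<^sup>2))"
  have "?s \<longlonglongrightarrow> 0"
  proof (rule tendsto_zero_of_slow_variation[where w = "\<lambda>k. \<alpha> k * \<gamma> k"])
    show "\<bar>?s (Suc k) - ?s k\<bar> \<le> (smoothness * sqrt g_moment + 1) * (\<alpha> k * \<gamma> k)" for k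
      by (rule gradF_slow_variation)
    show "summable (\<lambda>k. \<alpha> k * \<gamma> k * (?s k)\<^sup>2)"
      using summable_gradF_moments[OF min sums] by simp
    show "summable (\<lambda>k. (\<alpha> k * \<gamma> k)\<^sup>2)"
      using sums(2) by (simp add: power_mult_distrib)
  qed (use div steps_pos[THEN less_imp_le] in \<open>auto intro!: mult_nonneg_nonneg\<close>)
  then have "(\<lambda>k. (?s k)\<^sup>2) \<longlonglongrightarrow> 0\<^sup>2"
    by (rule tendsto_power)
  then show ?thesis by simp
qed

end


text \<open>The integrability conjunct secures the meaning of the other two, since the integral of a
  non-integrable function is 0 by convention.\<close>

theorem mainTheorem1:
  fixes M :: "'w measure"
    and N :: nat
    and D :: "nat \<Rightarrow> 'x measure"
    and f :: "nat \<Rightarrow> real ^ 'd \<Rightarrow> 'x \<Rightarrow> real"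
    and U :: "'u measure"
    and Q :: "real \<Rightarrow> 'u \<Rightarrow> real"
    and p :: real
    and \<alpha> \<gamma> :: "nat \<Rightarrow> real"
    and \<xi> :: "nat \<Rightarrow> nat \<Rightarrow> 'w \<Rightarrow> 'x"
    and \<Phi> :: "nat \<Rightarrow> 'w \<Rightarrow> real ^ 'd"
    and S :: "nat \<Rightarrow> 'w \<Rightarrow> nat set"
    and V :: "nat \<Rightarrow> nat \<Rightarrow> 'w \<Rightarrow> 'u"
    and W :: "nat \<Rightarrow> 'w \<Rightarrow> 'u"
    and \<theta>0 :: "real ^ 'd"
    and \<delta> :: "nat \<Rightarrow> nat \<Rightarrow> 'w \<Rightarrow> real"
    and \<Delta> :: "nat \<Rightarrow> 'w \<Rightarrow> real"
    and g :: "nat \<Rightarrow> 'w \<Rightarrow> real ^ 'd"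
    and \<theta> :: "nat \<Rightarrow> 'w \<Rightarrow> real ^ 'd"
    and \<theta>min :: "real ^ 'd"
    and \<alpha>1 \<alpha>2 \<alpha>3 L\<xi> \<sigma> :: real
    and L :: "nat \<Rightarrow> 'x \<Rightarrow> real"
  assumes dzofl: "dzofl M N D f U Q p \<alpha> \<gamma> \<xi> \<Phi> S V W \<theta>0 \<delta> \<Delta> g \<theta>"
    and minimizer: "\<forall>t. global_objective N D f \<theta>min \<le> global_objective N D f t"
    and stationary: "gradient (global_objective N D f) \<theta>min = 0"
    and grad_exists: "\<forall>i\<in>{1..N}. \<forall>t. has_gradient_at (local_objective D f i) t"
    and grad_continuous: "\<forall>i\<in>{1..N}. continuous_on UNIV (gradient (local_objective D f i))"
    and hess_exists: "\<forall>i\<in>{1..N}. \<forall>t. gradient (local_objective D f i) differentiable (at t)"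
    and hess_continuous: "\<forall>i\<in>{1..N}. continuous_on UNIV (hessian (local_objective D f i))"
    and \<alpha>1_pos: "0 < \<alpha>1"
    and hess_bound: "\<forall>i\<in>{1..N}. \<forall>t. onorm ((*v) (hessian (local_objective D f i) t)) \<le> \<alpha>1"
    and L_measurable: "\<forall>i\<in>{1..N}. L i \<in> borel_measurable (D i)"
    and lipschitz: "\<forall>i\<in>{1..N}. \<forall>x\<in>space (D i). \<forall>t t'. \<bar>f i t x - f i t' x\<bar> \<le> L i x * norm (t - t')"
    and L_second_moment: "\<forall>k. AE \<omega> in M.
      (MAX i\<in>{1..N}. nn_cond_exp M (history M N D \<xi> \<theta> k) (\<lambda>\<omega>. ennreal ((L i (\<xi> i k \<omega>))\<^sup>2)) \<omega>)
        = ennreal L\<xi>"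
    and f_integrable: "\<forall>i\<in>{1..N}. \<forall>t. integrable (D i) (f i t)"
    and steps_pos: "\<forall>k. 0 < \<alpha> k" "\<forall>k. 0 < \<gamma> k"
    and steps_lim: "\<alpha> \<longlonglongrightarrow> 0" "\<gamma> \<longlonglongrightarrow> 0"
    and steps_sum: "filterlim (\<lambda>n. \<Sum>k<n. \<alpha> k * \<gamma> k) at_top sequentially"
      "summable (\<lambda>k. \<alpha> k * \<gamma> k ^ 3)"
      "summable (\<lambda>k. (\<alpha> k)\<^sup>2 * (\<gamma> k)\<^sup>2)"
    and Q_unbiased: "quantizer_unbiased U Q"
    and \<sigma>_pos: "0 < \<sigma>"
    and Q_variance: "quantizer_variance_bound U Q \<sigma>"
    and \<Phi>_indep: "prob_space.indep_vars M (\<lambda>_. borel) \<Phi> UNIV"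
    and \<Phi>_entries_indep: "\<forall>k. prob_space.indep_vars M (\<lambda>_. borel) (\<lambda>j \<omega>. \<Phi> k \<omega> $ j) UNIV"
    and \<Phi>_entries_distr: "\<forall>k j j'. distr M borel (\<lambda>\<omega>. \<Phi> k \<omega> $ j) = distr M borel (\<lambda>\<omega>. \<Phi> k \<omega> $ j')"
    and \<Phi>_uncorrelated: "\<forall>k j j'. j \<noteq> j' \<longrightarrow> (\<integral>\<omega>. \<Phi> k \<omega> $ j * \<Phi> k \<omega> $ j' \<partial>M) = 0"
    and \<alpha>2_pos: "0 < \<alpha>2"
    and \<Phi>_second_moment: "\<forall>k j. (\<integral>\<omega>. (\<Phi> k \<omega> $ j)\<^sup>2 \<partial>M) = \<alpha>2"
    and \<alpha>3_pos: "0 < \<alpha>3"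
    and \<Phi>_bounded: "\<forall>k. AE \<omega> in M. norm (\<Phi> k \<omega>) \<le> \<alpha>3"
  shows "(\<forall>k. integrable M (\<lambda>\<omega>. (norm (gradient (global_objective N D f) (\<theta> k \<omega>)))\<^sup>2)) \<and>
    summable (\<lambda>k. \<alpha> k * \<gamma> k * (\<integral>\<omega>. (norm (gradient (global_objective N D f) (\<theta> k \<omega>)))\<^sup>2 \<partial>M)) \<and>
    (\<lambda>k. \<integral>\<omega>. (norm (gradient (global_objective N D f) (\<theta> k \<omega>)))\<^sup>2 \<partial>M) \<longlonglongrightarrow> 0"
proof -
  interpret dzofl M N D f U Q p \<alpha> \<gamma> \<xi> \<Phi> S V W \<theta>0 \<delta> \<Delta> g \<theta>
    by (rule dzofl)
  interpret dzofl_smooth M N D f U Q p \<alpha> \<gamma> \<xi> \<Phi> S V W \<theta>0 \<delta> \<Delta> g \<theta> \<alpha>1 \<alpha>2 \<alpha>3 L\<xi> \<sigma> L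
    by (intro dzofl_smooth.intro dzofl dzofl_smooth_axioms.intro)
      (rule grad_exists[rule_format] hess_exists[rule_format] hess_bound[rule_format]
        L_measurable[rule_format] lipschitz[rule_format] L_second_moment[rule_format]
        f_integrable[rule_format] steps_pos[rule_format] \<Phi>_uncorrelated[rule_format]
        \<Phi>_second_moment[rule_format] \<Phi>_bounded[rule_format]
        Q_unbiased Q_variance \<alpha>1_pos \<alpha>2_pos \<alpha>3_pos \<sigma>_pos; assumption)+
  have div: "\<not> summable (\<lambda>k. \<alpha> k * \<gamma> k)"
  proof
    assume "summable (\<lambda>k. \<alpha> k * \<gamma> k)"
    then have "(\<lambda>n. \<Sum>k<n. \<alpha> k * \<gamma> k) \<longlonglongrightarrow> (\<Sum>k. \<alpha> k * \<gamma> k)"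
      by (rule summable_LIMSEQ)
    with steps_sum(1) show False
      using not_tendsto_and_filterlim_at_infinity[OF sequentially_bot]
      by (blast intro: filterlim_at_top_imp_at_infinity)
  qed
  have min: "global_objective N D f \<theta>min \<le> global_objective N D f t" for t
    using minimizer by blast
  show ?thesis
    by (intro conjI allI integrable_gradF_square summable_gradF_moments[OF min steps_sum(2,3)]
        gradF_moments_tendsto_zero[OF min div steps_sum(2,3)])
qed

end
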